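(* Let $k\in\mathbb{Z}^+$ be a positive integer and let $\mathbb{H}_{1/k} = \{(z_1,z_2)\in\mathbb{C}^2 : |z_1|^{1/k} < |z_2| < 1\}$. Then the Bergman kernel $\mathbb{B}_{1/k}$ of $\mathbb{H}_{1/k}$ is given, for all $z=(z_1,z_2), w=(w_1,w_2)\in\mathbb{H}_{1/k}$, by $$\mathbb{B}_{1/k}(z,w) = \frac{t^k}{\pi^2(1-t)^2(t^k-s)^2},$$ where $s = z_1\bar w_1$ and $t = z_2\bar w_2$.
   Context: For a domain $\Omega\subset\mathbb{C}^n$, the Bergman space $A^2(\Omega)$ is the Hilbert space of holomorphic functions on $\Omega$ that are square-integrable with respect to Lebesgue measure $dV$, with inner product $\langle f,g\rangle=\int_\Omega f\bar g\,dV$. The Bergman kernel of $\Omega$ is the function $\mathbb{B}_\Omega:\Omega\times\Omega\to\mathbb{C}$, given by the Riesz representation theorem, such that $\overline{\mathbb{B}_\Omega(z,\cdot)}\in A^2(\Omega)$ for each $z\in\Omega$ and $f(z)=\int_\Omega \mathbb{B}_\Omega(z,w)f(w)\,dV(w)$ for all $f\in A^2(\Omega)$, $z\in\Omega$. For $\gamma>0$, $\mathbb{H}_\gamma=\{(z_1,z_2)\in\mathbb{C}^2:|z_1|^\gamma<|z_2|<1\}$, and $\mathbb{B}_\gamma$ denotes its Bergman kernel. *)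

theory Defs
  imports "HOL-Analysis.Analysis"
begin

definition holomorphic_vec_on :: "(complex ^ 'n \<Rightarrow> complex) \<Rightarrow> (complex ^ 'n) set \<Rightarrow> bool" where
  "holomorphic_vec_on f \<Omega> \<longleftrightarrow>
     (\<forall>z\<in>\<Omega>. \<exists>D. (f has_derivative D) (at z) \<and> (\<forall>c v. D (c *s v) = c * D v))"

text \<open>Functions are total here, so an element of the Bergman space is unconstrained outside the
  open set \<open>\<Omega>\<close>; only its values on \<open>\<Omega>\<close> are meaningful.\<close>

definition bergman_space :: "(complex ^ 'n) set \<Rightarrow> (complex ^ 'n \<Rightarrow> complex) set" where
  "bergman_space \<Omega> =
     {f. holomorphic_vec_on f \<Omega> \<and> set_integrable lborel \<Omega> (\<lambda>z. (cmod (f z))\<^sup>2)}"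

definition is_bergman_kernel ::
    "(complex ^ 'n) set \<Rightarrow> (complex ^ 'n \<Rightarrow> complex ^ 'n \<Rightarrow> complex) \<Rightarrow> bool" where
  "is_bergman_kernel \<Omega> B \<longleftrightarrow>
     (\<forall>z\<in>\<Omega>. (\<lambda>w. cnj (B z w)) \<in> bergman_space \<Omega>) \<and>
     (\<forall>f\<in>bergman_space \<Omega>. \<forall>z\<in>\<Omega>. f z = (LINT w:\<Omega>|lborel. B z w * f w))"

text \<open>The characterising property determines the kernel only on \<open>\<Omega> \<times> \<Omega>\<close>. It is extended by
  zero, so that the description below denotes a unique total function.\<close>

definition bergman_kernel ::
    "(complex ^ 'n) set \<Rightarrow> complex ^ 'n \<Rightarrow> complex ^ 'n \<Rightarrow> complex" where
  "bergman_kernel \<Omega> =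
     (THE B. is_bergman_kernel \<Omega> B \<and> (\<forall>z w. z \<notin> \<Omega> \<or> w \<notin> \<Omega> \<longrightarrow> B z w = 0))"

definition hartogs_triangle :: "real \<Rightarrow> (complex ^ 2) set" where
  "hartogs_triangle \<gamma> = {z. cmod (z $ 1) powr \<gamma> < cmod (z $ 2) \<and> cmod (z $ 2) < 1}"

end

theory Submission imports Defs "HOL-Complex_Analysis.Conformal_Mappings" begin

text \<open>
  The map \<open>(c, v) \<mapsto> (c v\<^sup>k, v)\<close> identifies the product of the unit disc and the punctured unit disc
  with the Hartogs triangle, with Jacobian determinant \<open>v\<^sup>k\<close>. The stated kernel is what this
  identification produces from the product of the Bergman kernels of the two factors: the first factor has
  kernel \<open>1 / (\<pi> (1 - a cnj b)\<^sup>2)\<close>, and so has the second, because square-integrable holomorphic functions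
  do not see the puncture.

  The proof uses this picture slice by slice, without a change of variables in two complex
  dimensions. For fixed second coordinate \<open>v\<close> the slice of the domain is the disc of radius \<open>|v|\<^sup>k\<close>, on
  which the proposed kernel is a multiple of the Bergman kernel of that disc at the point
  \<open>c v\<^sup>k\<close>, \<open>c = z $ 1 / z $ 2 ^ k\<close> (\<open>hartogs_kernel_slice\<close>). The integral over the slice is thus given by
  the value of \<open>f\<close> at \<open>(c v\<^sup>k, v)\<close>, and what remains is the reproducing formula on the punctured disc for
  \<open>v \<mapsto> v\<^sup>k f (c v\<^sup>k, v)\<close> (\<open>hartogs_kernel_reproducing\<close>). The kernel itself is square-integrable
  (\<open>hartogs_kernel_in_bergman_space\<close>), and reproducing kernels are unique (\<open>bergman_kernel_eqI\<close>).

  The reproducing formula on a disc (\<open>disc_reproducing\<close>) follows from the rotation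
  invariance of Lebesgue measure: averaging the integrand over rotations turns it into a
  radial function, which Cauchy's integral formula computes, and a radial function over a disc is
  integrated as a function of \<open>|w|\<^sup>2\<close> on an interval. It also bounds point values of a
  holomorphic function by its norm (\<open>disc_point_evaluation_bound\<close>). This bound is used to
  remove the puncture (\<open>punctured_disc_reproducing\<close>) and to see that
  \<open>v \<mapsto> v\<^sup>k f (c v\<^sup>k, v)\<close> is square-integrable.
\<close>

section \<open>Lebesgue measure on the complex plane and on pairs of complex numbers\<close>

definition vec2 :: "'a \<Rightarrow> 'a \<Rightarrow> 'a ^ 2" where
  "vec2 a b = (\<chi> i. if i = 1 then a else b)"

lemma vec2_nth [simp]: "vec2 a b $ 1 = a" "vec2 a b $ 2 = b"
  by (auto simp: vec2_def)

lemma vec2_eta [simp]: "vec2 (z $ 1) (z $ 2) = z"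
  by (simp add: vec_eq_iff forall_2)

lemma continuous_on_vec2 [continuous_intros]:
  assumes "continuous_on S p" "continuous_on S q"
  shows "continuous_on S (\<lambda>x. vec2 (p x) (q x))"
proof -
  have "continuous_on S (\<lambda>x. if i = 1 then p x else q x)" for i :: 2
    using assms by (cases "i = 1") auto
  then show ?thesis
    unfolding vec2_def by (intro continuous_on_vec_lambda)
qed

lemma measurable_vec2 [measurable]:
  "(\<lambda>p::complex \<times> complex. vec2 (snd p) (fst p)) \<in> borel_measurable borel"
  by (intro borel_measurable_continuous_onI continuous_intros)

text \<open>The second coordinate is put first in the product: in the Hartogs triangle the range of
  \<open>z $ 1\<close> depends on \<open>z $ 2\<close>, so iterated integrals have \<open>z $ 2\<close> as the outer variable, and
  with this order the outer variable is the first component that the product-measure lemmas expect.\<close>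

lemma lborel_vec2:
  "(lborel :: (complex ^ 2) measure) =
     distr (lborel \<Otimes>\<^sub>M lborel) borel (\<lambda>p. vec2 (snd p) (fst p))"
proof (rule lborel_eqI)
  fix l u :: "complex ^ 2"
  assume le: "\<And>b. b \<in> Basis \<Longrightarrow> l \<bullet> b \<le> u \<bullet> b"
  have B: "(Basis :: (complex ^ 2) set) = {axis 1 1, axis 1 \<i>, axis 2 1, axis 2 \<i>}"
    by (auto simp: Basis_vec_def Basis_complex_def UNIV_2)
  have "(\<lambda>p. vec2 (snd p) (fst p)) -` box l u = box (l $ 2, l $ 1) (u $ 2, u $ 1)"
    by (auto simp: box_def B inner_axis Basis_prod_def Basis_complex_def ball_Un)
  then have "emeasure (distr (lborel \<Otimes>\<^sub>M lborel) borel (\<lambda>p. vec2 (snd p) (fst p))) (box l u)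
     = emeasure lborel (box (l $ 2, l $ 1) (u $ 2, u $ 1))"
    by (subst emeasure_distr) (simp_all add: lborel_prod)
  also have "\<dots> = emeasure lborel (box (l $ 2) (u $ 2) \<times> box (l $ 1) (u $ 1))"
    by (intro arg_cong[where f = "emeasure lborel"])
       (auto simp: box_def Basis_prod_def Basis_complex_def ball_Un)
  also have "\<dots> = emeasure lborel (box (l $ 2) (u $ 2)) * emeasure lborel (box (l $ 1) (u $ 1))"
    by (subst lborel_prod [symmetric], subst lborel.emeasure_pair_measure_Times) auto
  also have "\<dots> = (\<Prod>b\<in>Basis. (u - l) \<bullet> b)"
    using le[of "axis 1 1"] le[of "axis 1 \<i>"] le[of "axis 2 1"] le[of "axis 2 \<i>"]
    by (simp add: emeasure_lborel_box_eq B inner_axis Basis_complex_def axis_eq_axis mult_ac flip: ennreal_mult)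
  finally show "emeasure (distr (lborel \<Otimes>\<^sub>M lborel) borel (\<lambda>p. vec2 (snd p) (fst p))) (box l u)
     = (\<Prod>b\<in>Basis. (u - l) \<bullet> b)" .
qed simp

text \<open>This identification carries the invariance of Lebesgue measure under orthogonal maps, available for
  real coordinate spaces, over to multiplication by a unimodular complex number.\<close>

lemma lborel_complex_eq_distr:
  "(lborel :: complex measure) = distr lborel borel (\<lambda>v::real ^ 2. Complex (v $ 1) (v $ 2))"
proof (rule lborel_eqI)
  fix l u :: complex
  assume le: "\<And>b. b \<in> Basis \<Longrightarrow> l \<bullet> b \<le> u \<bullet> b"
  have meas [measurable]: "(\<lambda>v::real ^ 2. Complex (v $ 1) (v $ 2)) \<in> borel_measurable borel"
    by (intro borel_measurable_continuous_onI continuous_on_Complex continuous_intros)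
  have B: "(Basis :: (real ^ 2) set) = {axis 1 1, axis 2 1}"
    by (auto simp: Basis_vec_def UNIV_2)
  have "(\<lambda>v. Complex (v $ 1) (v $ 2)) -` box l u = box (vec2 (Re l) (Im l)) (vec2 (Re u) (Im u))"
    by (auto simp: box_def B inner_axis Basis_complex_def)
  then show "emeasure (distr lborel borel (\<lambda>v::real ^ 2. Complex (v $ 1) (v $ 2))) (box l u)
     = (\<Prod>b\<in>Basis. (u - l) \<bullet> b)"
    using le[of 1] le[of \<i>]
    by (subst emeasure_distr)
       (simp_all add: emeasure_lborel_box_eq B Basis_complex_def inner_axis axis_eq_axis complex_eq_iff)
qed simp

text \<open>Read in the real coordinates \<open>P\<close>, the preimage of a box under multiplication by \<open>u\<close> is
  the image of the box under the orthogonal map \<open>T\<close>, multiplication by \<open>cnj u\<close>. Orthogonal maps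
  preserve volume, and a measure that gives all boxes their volume is Lebesgue measure.\<close>

lemma lborel_distr_rotation:
  fixes u :: complex
  assumes u: "cmod u = 1"
  shows "lborel = distr lborel borel ((*) u)"
proof (rule lborel_eqI)
  fix a b :: complex
  assume le: "\<And>i. i \<in> Basis \<Longrightarrow> a \<bullet> i \<le> b \<bullet> i"
  define P where "P = (\<lambda>v::real ^ 2. Complex (v $ 1) (v $ 2))"
  define T where "T = (\<lambda>v::real ^ 2. vec2 (Re (cnj u * P v)) (Im (cnj u * P v)))"
  have P [measurable]: "P \<in> borel_measurable borel"
    unfolding P_def by (intro borel_measurable_continuous_onI continuous_on_Complex continuous_intros)
  have lP: "lborel = distr lborel borel P"
    unfolding P_def by (rule lborel_complex_eq_distr)
  have "linear T"
    unfolding T_def P_def by (rule linearI) (auto simp: vec_eq_iff forall_2 algebra_simps)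
  moreover have "norm (T v) = norm v" for v
  proof -
    have "norm (T v) = cmod (cnj u * P v)"
      by (simp add: norm_vec_def L2_set_def sum_2 T_def cmod_def)
    also have "\<dots> = cmod (P v)" using u by (simp add: norm_mult)
    also have "\<dots> = norm v" by (simp add: norm_vec_def L2_set_def sum_2 P_def cmod_def)
    finally show ?thesis .
  qed
  ultimately have T: "orthogonal_transformation T"
    by (simp add: orthogonal_transformation)
  have PT: "P (T v) = cnj u * P v" for v by (simp add: P_def T_def complex_eq_iff)
  have uu: "u * cnj u = 1" using u by (simp add: complex_mult_cnj cmod_def)
  have Pu: "P (vec2 (Re (u * P v)) (Im (u * P v))) = u * P v" for v
    by (simp add: P_def complex_eq_iff)
  have inv: "T (vec2 (Re (u * P v)) (Im (u * P v))) = v" for v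
  proof -
    have "P (T (vec2 (Re (u * P v)) (Im (u * P v)))) = P v"
      using uu Pu by (metis PT mult.assoc mult.commute mult.left_neutral)
    then show ?thesis by (simp add: P_def vec_eq_iff forall_2)
  qed
  have boxP: "bounded (P -` box a b)"
  proof -
    have "norm (P v) = norm v" for v by (simp add: norm_vec_def L2_set_def sum_2 P_def cmod_def)
    then show ?thesis using bounded_box[of a b] unfolding bounded_iff by (metis vimage_eq)
  qed
  have bor: "P -` box a b \<in> sets borel" using measurable_sets[OF P, of "box a b"] by simp
  have lm: "P -` box a b \<in> lmeasurable"
    using boxP bor by (simp add: bounded_set_imp_lmeasurable)
  have eq: "P -` (((*) u) -` box a b) = T ` (P -` box a b)"
  proof (intro equalityI subsetI)
    fix v assume "v \<in> P -` (((*) u) -` box a b)"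
    then have "vec2 (Re (u * P v)) (Im (u * P v)) \<in> P -` box a b"
      by (simp only: vimage_eq Pu)
    then show "v \<in> T ` (P -` box a b)" using inv by (metis image_eqI)
  next
    fix v assume "v \<in> T ` (P -` box a b)"
    then show "v \<in> P -` (((*) u) -` box a b)"
      using uu by (auto simp: PT mult.assoc [symmetric])
  qed
  have bor2: "P -` (((*) u) -` box a b) \<in> sets borel"
    using measurable_sets[of "\<lambda>v. u * P v" borel borel "box a b"] by (simp add: vimage_def)
  have lm2: "T ` (P -` box a b) \<in> lmeasurable" by (rule measurable_orthogonal_image[OF T lm])
  have m: "measure lebesgue (T ` (P -` box a b)) = measure lebesgue (P -` box a b)"
    by (rule measure_orthogonal_image[OF T lm])
  have "emeasure (distr lborel borel ((*) u)) (box a b) = emeasure lborel (((*) u) -` box a b)"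
    by (subst emeasure_distr) auto
  also have "\<dots> = emeasure lborel (P -` (((*) u) -` box a b))"
    using measurable_sets[of "(*) u" borel borel "box a b"]
    by (subst lP, subst emeasure_distr) auto
  also have "\<dots> = emeasure lebesgue (T ` (P -` box a b))"
    using bor2 by (simp add: eq)
  also have "\<dots> = emeasure lebesgue (P -` box a b)"
    using lm lm2 m by (metis emeasure_eq_measure2 fmeasurableD fmeasurableD2 emeasure_eq_ennreal_measure top.not_eq_extremum)
  also have "\<dots> = emeasure lborel (P -` box a b)" using bor by simp
  also have "\<dots> = emeasure (distr lborel borel P) (box a b)" by (subst emeasure_distr) auto
  also have "\<dots> = emeasure lborel (box a b)" by (simp flip: lP)
  also have "\<dots> = (\<Prod>i\<in>Basis. (b - a) \<bullet> i)" using le by (simp add: emeasure_lborel_box_eq)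
  finally show "emeasure (distr lborel borel ((*) u)) (box a b) = (\<Prod>i\<in>Basis. (b - a) \<bullet> i)" .
qed simp

section \<open>Averages over discs and circles\<close>

text \<open>This is integration in polar coordinates for radial functions. It needs nothing but areas of discs:
  the push-forward of area measure on the disc under \<open>w \<mapsto> |w|\<^sup>2\<close> gives the ray above \<open>x\<close>
  the area \<open>\<pi> (R\<^sup>2 - x)\<close> of an annulus, hence it is \<open>\<pi>\<close> times length on \<open>[0, R\<^sup>2]\<close>.\<close>

lemma integral_disc_radial:
  fixes \<phi> :: "real \<Rightarrow> complex"
  assumes R: "R > 0" and [measurable]: "\<phi> \<in> borel_measurable borel"
  shows "(LINT w:ball (0::complex) R|lborel. \<phi> ((cmod w)\<^sup>2)) =
           complex_of_real pi * (LINT s:{0..R\<^sup>2}|lborel. \<phi> s)"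
proof -
  define M where "M = distr (density lborel (\<lambda>w. ennreal (indicator (ball (0::complex) R) w)))
    borel (\<lambda>w. (cmod w)\<^sup>2)"
  define N where "N = density lborel (\<lambda>s. ennreal (pi * indicator {0..R\<^sup>2} s))"
  have ball: "emeasure lborel (ball (0::complex) r) = ennreal (pi * r\<^sup>2)" if "r \<ge> 0" for r
    using that by (simp add: emeasure_ball unit_ball_vol_2)
  have cball: "emeasure lborel (cball (0::complex) r) = ennreal (pi * r\<^sup>2)" if "r \<ge> 0" for r
    using that by (simp add: emeasure_cball unit_ball_vol_2)
  have eM: "emeasure M {x<..} = emeasure lborel (ball (0::complex) R \<inter> {w. x < (cmod w)\<^sup>2})" for x
  proof -
    have S: "{w::complex. x < (cmod w)\<^sup>2} \<in> sets lborel" by measurable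
    have "(\<lambda>w::complex. (cmod w)\<^sup>2) -` {x<..} = {w. x < (cmod w)\<^sup>2}" by auto
    then have "emeasure M {x<..} = (\<integral>\<^sup>+w. indicator (ball (0::complex) R) w * indicator {w. x < (cmod w)\<^sup>2} w \<partial>lborel)"
      unfolding M_def using S
      by (subst emeasure_distr, simp, simp, subst emeasure_density)
         (simp_all add: ennreal_indicator borel_measurable_indicator)
    also have "\<dots> = (\<integral>\<^sup>+w. indicator (ball (0::complex) R \<inter> {w. x < (cmod w)\<^sup>2}) w \<partial>lborel)"
      by (simp add: indicator_inter_arith)
    finally show ?thesis by simp
  qed
  have eN: "emeasure N {x<..} = ennreal pi * emeasure lborel ({0..R\<^sup>2} \<inter> {x<..})" for x
  proof -
    have "emeasure N {x<..} = (\<integral>\<^sup>+s. ennreal pi * indicator ({0..R\<^sup>2} \<inter> {x<..}) s \<partial>lborel)"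
      unfolding N_def
      by (simp add: emeasure_density ennreal_indicator ennreal_mult' mult.assoc indicator_inter_arith)
    then show ?thesis by (simp add: nn_integral_cmult)
  qed
  have "M = N"
  proof (rule measure_eqI_lessThan)
    show "sets M = sets borel" "sets N = sets borel" by (auto simp: M_def N_def)
  next
    fix x
    have "emeasure M {x<..} \<le> emeasure lborel (ball (0::complex) R)"
      unfolding eM by (rule emeasure_mono) auto
    also have "\<dots> < \<infinity>" using ball[of R] R by simp
    finally show "emeasure M {x<..} < \<infinity>" .
    consider "x < 0" | "0 \<le> x" "x < R\<^sup>2" | "R\<^sup>2 \<le> x" by linarith
    then show "emeasure M {x<..} = emeasure N {x<..}"
    proof cases
      case 1
      then have "ball (0::complex) R \<inter> {w. x < (cmod w)\<^sup>2} = ball 0 R"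
        by (auto intro: less_le_trans)
      moreover have "{0..R\<^sup>2} \<inter> {x<..} = {0..R\<^sup>2}" using 1 by auto
      ultimately show ?thesis using R by (simp add: eM eN ball ennreal_mult)
    next
      case 2
      have "ball (0::complex) R \<inter> {w. x < (cmod w)\<^sup>2} = ball 0 R - cball 0 (sqrt x)"
        using 2 by (auto simp: not_le real_less_lsqrt real_less_rsqrt real_sqrt_less_iff
          intro: real_less_rsqrt dest: real_less_lsqrt)
           (metis norm_ge_zero real_sqrt_less_iff real_sqrt_abs abs_of_nonneg sqrt_le_D not_le)+
      moreover have "emeasure lborel (ball (0::complex) R - cball 0 (sqrt x)) =
          ennreal (pi * R\<^sup>2) - ennreal (pi * x)"
      proof -
        have "sqrt x < R" using 2 R by (simp add: real_less_lsqrt)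
        then have "cball (0::complex) (sqrt x) \<subseteq> ball 0 R" by auto
        then show ?thesis using 2 R ball[of R] cball[of "sqrt x"]
          by (subst emeasure_Diff) auto
      qed
      moreover have "{0..R\<^sup>2} \<inter> {x<..} = {x<..R\<^sup>2}" using 2 by auto
      ultimately show ?thesis
        using 2 by (simp add: eM eN ennreal_minus right_diff_distrib flip: ennreal_mult)
    next
      case 3
      then have "ball (0::complex) R \<inter> {w. x < (cmod w)\<^sup>2} = {}"
        using R by (auto simp: not_less) (smt (verit) norm_ge_zero power_mono)
      moreover have "{0..R\<^sup>2} \<inter> {x<..} = {}" using 3 by auto
      ultimately show ?thesis by (simp add: eM eN)
    qed
  qed
  moreover have "integral\<^sup>L M \<phi> = (LINT w:ball (0::complex) R|lborel. \<phi> ((cmod w)\<^sup>2))"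
    unfolding M_def set_lebesgue_integral_def
    by (subst integral_distr, simp, simp, subst integral_density)
       (auto intro!: borel_measurable_indicator)
  moreover have "integral\<^sup>L N \<phi> = complex_of_real pi * (LINT s:{0..R\<^sup>2}|lborel. \<phi> s)"
    unfolding N_def set_lebesgue_integral_def
    by (subst integral_density) (auto simp: scaleR_conv_of_real mult.assoc)
  ultimately show ?thesis by simp
qed

lemma set_integrable_bounded_mult:
  fixes f q :: "'a::euclidean_space \<Rightarrow> complex"
  assumes f: "set_integrable lborel A f" and A: "A \<in> sets borel" and q: "continuous_on A q"
    and B: "\<And>x. x \<in> A \<Longrightarrow> cmod (q x) \<le> B"
  shows "set_integrable lborel A (\<lambda>x. q x * f x)"
  unfolding set_integrable_def
proof (rule Bochner_Integration.integrable_bound)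
  have [measurable]: "(\<lambda>x. indicator A x *\<^sub>R q x) \<in> borel_measurable borel"
    by (rule borel_measurable_continuous_on_indicator[OF A q])
  have [measurable]: "(\<lambda>x. indicator A x *\<^sub>R f x) \<in> borel_measurable lborel"
    using f unfolding set_integrable_def by auto
  have "(\<lambda>x. (indicator A x *\<^sub>R q x) * (indicator A x *\<^sub>R f x)) \<in> borel_measurable lborel"
    by measurable
  also have "(\<lambda>x. (indicator A x *\<^sub>R q x) * (indicator A x *\<^sub>R f x)) =
      (\<lambda>x. indicator A x *\<^sub>R (q x * f x))" by (auto simp: indicator_def)
  finally show "(\<lambda>x. indicator A x *\<^sub>R (q x * f x)) \<in> borel_measurable lborel" .
  show "integrable lborel (\<lambda>x. B *\<^sub>R (indicator A x *\<^sub>R f x))"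
    using f unfolding set_integrable_def by (intro integrable_scaleR_right)
  show "AE x in lborel. norm (indicator A x *\<^sub>R (q x * f x)) \<le> norm (B *\<^sub>R (indicator A x *\<^sub>R f x))"
    using B by (intro AE_I2) (auto simp: indicator_def norm_mult intro!: mult_right_mono
      intro: order_trans[OF _ abs_ge_self])
qed

text \<open>Rotating the argument leaves the integral over the disc unchanged, so it may be averaged over
  all angles; Fubini then moves the average over angles inside. The inner integral runs over a circle,
  where Cauchy's formula applies.\<close>

lemma integral_disc_rotation_average:
  fixes F :: "complex \<Rightarrow> complex"
  assumes F: "set_integrable lborel (ball 0 R) F"
  shows "2 * complex_of_real pi * (LINT w:ball 0 R|lborel. F w) =
    (LINT w:ball 0 R|lborel. LINT \<theta>:{0..2 * pi}|lborel. F (cis \<theta> * w))"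
proof -
  define G where "G = (\<lambda>w. indicator (ball 0 R) w *\<^sub>R F w)"
  have G: "integrable lborel G" using F by (simp add: G_def set_integrable_def)
  then have [measurable]: "G \<in> borel_measurable borel" by auto
  have rot: "integrable lborel (\<lambda>w. G (cis \<theta> * w))"
            "(\<integral>w. G (cis \<theta> * w) \<partial>lborel) = (\<integral>w. G w \<partial>lborel)"
            "(\<integral>w. norm (G (cis \<theta> * w)) \<partial>lborel) = (\<integral>w. norm (G w) \<partial>lborel)" for \<theta>
  proof -
    have e: "lborel = distr lborel borel ((*) (cis \<theta>))" by (rule lborel_distr_rotation) simp
    show "integrable lborel (\<lambda>w. G (cis \<theta> * w))"
      using G by (subst (asm) e, subst (asm) integrable_distr_eq) auto
    show "(\<integral>w. G (cis \<theta> * w) \<partial>lborel) = (\<integral>w. G w \<partial>lborel)"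
      by (subst (2) e, subst integral_distr) auto
    show "(\<integral>w. norm (G (cis \<theta> * w)) \<partial>lborel) = (\<integral>w. norm (G w) \<partial>lborel)"
      by (subst (2) e, subst integral_distr) auto
  qed
  have [measurable]: "cis \<in> borel_measurable borel"
    by (intro borel_measurable_continuous_onI continuous_intros)
  define H where "H = (\<lambda>\<theta> w. indicator {0..2 * pi} \<theta> *\<^sub>R G (cis \<theta> * w))"
  have H: "integrable (lborel \<Otimes>\<^sub>M lborel) (\<lambda>(\<theta>, w). H \<theta> w)"
  proof (rule lborel_pair.Fubini_integrable)
    show "(\<lambda>(\<theta>, w). H \<theta> w) \<in> borel_measurable (lborel \<Otimes>\<^sub>M lborel)"
      unfolding H_def by measurable
    have "integrable lborel (\<lambda>\<theta>. indicator {0..2 * pi} \<theta> * (\<integral>w. norm (G w) \<partial>lborel))"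
      by (intro integrable_mult_left integrable_real_indicator) auto
    then show "integrable lborel (\<lambda>\<theta>. \<integral>w. norm (case (\<theta>, w) of (\<theta>, w) \<Rightarrow> H \<theta> w) \<partial>lborel)"
      by (simp add: H_def rot)
    show "AE \<theta> in lborel. integrable lborel (\<lambda>w. case (\<theta>, w) of (\<theta>, w) \<Rightarrow> H \<theta> w)"
      by (simp add: H_def rot)
  qed
  have "(\<integral>w. (\<integral>\<theta>. H \<theta> w \<partial>lborel) \<partial>lborel) = (\<integral>\<theta>. (\<integral>w. H \<theta> w \<partial>lborel) \<partial>lborel)"
    by (rule lborel_pair.Fubini_integral[OF H])
  also have "\<dots> = (\<integral>\<theta>. indicator {0..2 * pi} \<theta> *\<^sub>R (\<integral>w. G w \<partial>lborel) \<partial>lborel)"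
    by (simp add: H_def rot)
  also have "\<dots> = 2 * complex_of_real pi * (\<integral>w. G w \<partial>lborel)"
    by (subst integral_scaleR_left) (auto simp: scaleR_conv_of_real)
  finally have "2 * complex_of_real pi * (\<integral>w. G w \<partial>lborel) = (\<integral>w. (\<integral>\<theta>. H \<theta> w \<partial>lborel) \<partial>lborel)" ..
  also have "(\<lambda>w. \<integral>\<theta>. H \<theta> w \<partial>lborel) = (\<lambda>w.
      indicator (ball 0 R) w *\<^sub>R (LINT \<theta>:{0..2 * pi}|lborel. F (cis \<theta> * w)))"
    by (auto simp: fun_eq_iff H_def G_def set_lebesgue_integral_def indicator_def norm_mult)
  finally show ?thesis by (simp add: G_def set_lebesgue_integral_def)
qed

text \<open>On the circle \<open>{u w. |u| = 1}\<close> conjugation is rational, \<open>cnj u = 1 / u\<close>. The kernel therefore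
  becomes \<open>u\<^sup>2 / (R\<^sup>2 (u - \<xi>))\<^sup>2\<close> with a pole at \<open>\<xi> = a cnj w / R\<^sup>2\<close> in the unit disc, and Cauchy's
  formula for the derivative of \<open>f u = u g (w u)\<close> at \<open>\<xi>\<close> evaluates the average. The result depends
  on \<open>w\<close> through \<open>|w|\<close> only, since \<open>w \<xi> = a |w|\<^sup>2 / R\<^sup>2\<close>.\<close>

lemma circle_average_bergman:
  fixes g :: "complex \<Rightarrow> complex" and a w :: complex and R :: real
  assumes R: "R > 0" and g: "g holomorphic_on ball 0 R" and a: "cmod a < R" and w: "cmod w < R"
  defines "\<zeta> \<equiv> a * complex_of_real ((cmod w)\<^sup>2 / R\<^sup>2)"
  shows "(LINT \<theta>:{0..2 * pi}|lborel. g (cis \<theta> * w) / (R\<^sup>2 - a * cnj (cis \<theta> * w))\<^sup>2) =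
    2 * complex_of_real pi / R ^ 4 * (g \<zeta> + \<zeta> * deriv g \<zeta>)"
proof -
  define \<xi> where "\<xi> = a * cnj w / R\<^sup>2"
  define f where "f = (\<lambda>u. u * g (w * u))"
  have "cmod a * cmod w < R * R" using a w R by (intro mult_strict_mono) auto
  then have \<xi>: "cmod \<xi> < 1" using R by (simp add: \<xi>_def norm_mult norm_divide power2_eq_square)
  have w\<xi>: "w * \<xi> = \<zeta>"
    by (simp add: \<xi>_def \<zeta>_def complex_norm_square mult_ac del: of_real_power)
  have wu: "w * u \<in> ball 0 R" if "cmod u \<le> 1" for u
    using that w mult_left_le[of "cmod u" "cmod w"] by (auto simp: norm_mult)
  have fcont: "continuous_on (cball 0 1) f"
    unfolding f_def using wu
    by (intro continuous_intros continuous_on_compose2[OF holomorphic_on_imp_continuous_on[OF g]]) auto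
  have fhol: "f holomorphic_on ball 0 1"
    unfolding f_def using wu
    by (intro holomorphic_intros holomorphic_on_compose_gen[OF _ g, unfolded o_def]) auto
  have d1: "(f has_field_derivative (1 / (2 * of_real pi * \<i>) *
      contour_integral (circlepath 0 1) (\<lambda>u. f u / (u - \<xi>)\<^sup>2))) (at \<xi>)"
    using \<xi> by (intro Cauchy_derivative_integral_circlepath fcont fhol) auto
  have d2: "(f has_field_derivative (g \<zeta> + \<zeta> * deriv g \<zeta>)) (at \<xi>)"
  proof -
    have "(g has_field_derivative deriv g (w * \<xi>)) (at (w * \<xi>))"
      using wu[of \<xi>] \<xi> g by (intro holomorphic_derivI[where S = "ball 0 R"]) auto
    then have "((\<lambda>u. g (w * u)) has_field_derivative deriv g (w * \<xi>) * w) (at \<xi>)"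
      by (rule DERIV_chain2) (auto intro!: derivative_eq_intros)
    then have "(f has_field_derivative 1 * g (w * \<xi>) + deriv g (w * \<xi>) * w * \<xi>) (at \<xi>)"
      unfolding f_def by (intro DERIV_mult DERIV_ident)
    then show ?thesis by (simp add: w\<xi> [symmetric] mult_ac)
  qed
  have c: "contour_integral (circlepath 0 1) (\<lambda>u. f u / (u - \<xi>)\<^sup>2) =
      2 * of_real pi * \<i> * (g \<zeta> + \<zeta> * deriv g \<zeta>)"
    using DERIV_unique[OF d1 d2] by (simp add: field_simps)
  have "contour_integral (circlepath 0 1) (\<lambda>u. f u / (u - \<xi>)\<^sup>2) =
      integral {0..2 * pi} (\<lambda>t. f (cis t) / (cis t - \<xi>)\<^sup>2 * \<i> * cis t)"
    unfolding circlepath_def by (subst contour_integral_part_circlepath_eq) auto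
  also have "(\<lambda>t. f (cis t) / (cis t - \<xi>)\<^sup>2 * \<i> * cis t) =
      (\<lambda>t. \<i> * R ^ 4 * (g (cis t * w) / (R\<^sup>2 - a * cnj (cis t * w))\<^sup>2))"
  proof
    fix t
    have "R\<^sup>2 - a * cnj (cis t * w) = R\<^sup>2 * (cis t - \<xi>) / cis t"
      using R by (simp add: \<xi>_def field_simps cis_cnj flip: cis_inverse)
    then have "(R\<^sup>2 - a * cnj (cis t * w))\<^sup>2 = R ^ 4 * (cis t - \<xi>)\<^sup>2 / (cis t)\<^sup>2"
      by (simp only: power_mult_distrib power_divide) (simp flip: power_mult)
    then show "f (cis t) / (cis t - \<xi>)\<^sup>2 * \<i> * cis t =
        \<i> * R ^ 4 * (g (cis t * w) / (R\<^sup>2 - a * cnj (cis t * w))\<^sup>2)"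
      using R by (simp only:) (simp add: f_def mult_ac power2_eq_square)
  qed
  also have "integral {0..2 * pi} \<dots> = \<i> * R ^ 4 *
      integral {0..2 * pi} (\<lambda>t. g (cis t * w) / (R\<^sup>2 - a * cnj (cis t * w))\<^sup>2)"
    by (rule integral_mult_right)
  also have "integral {0..2 * pi} (\<lambda>t. g (cis t * w) / (R\<^sup>2 - a * cnj (cis t * w))\<^sup>2) =
     (LINT \<theta>:{0..2 * pi}|lborel. g (cis \<theta> * w) / (R\<^sup>2 - a * cnj (cis \<theta> * w))\<^sup>2)"
  proof (rule set_borel_integral_eq_integral(2)[symmetric], rule borel_integrable_atLeastAtMost')
    have "R\<^sup>2 - a * cnj (cis t * w) \<noteq> 0" for t
    proof
      assume "R\<^sup>2 - a * cnj (cis t * w) = 0"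
      then have "cmod (R\<^sup>2) = cmod (a * cnj (cis t * w))" by simp
      then show False using \<open>cmod a * cmod w < R * R\<close> R by (simp add: norm_mult norm_power power2_eq_square)
    qed
    then show "continuous_on {0..2 * pi} (\<lambda>t. g (cis t * w) / (R\<^sup>2 - a * cnj (cis t * w))\<^sup>2)"
      using w by (intro continuous_intros continuous_on_compose2[OF holomorphic_on_imp_continuous_on[OF g]])
        (auto simp: norm_mult)
  qed
  finally have "\<i> * (2 * of_real pi * (g \<zeta> + \<zeta> * deriv g \<zeta>)) = \<i> * (R ^ 4 *
      (LINT \<theta>:{0..2 * pi}|lborel. g (cis \<theta> * w) / (R\<^sup>2 - a * cnj (cis \<theta> * w))\<^sup>2))"
    by (simp only: c mult_ac)
  then have "2 * of_real pi * (g \<zeta> + \<zeta> * deriv g \<zeta>) = R ^ 4 *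
      (LINT \<theta>:{0..2 * pi}|lborel. g (cis \<theta> * w) / (R\<^sup>2 - a * cnj (cis \<theta> * w))\<^sup>2)"
    by (simp only: mult_cancel_left) simp
  then show ?thesis using R by (simp add: nonzero_eq_divide_eq mult.commute)
qed

section \<open>The reproducing formula on discs and on the punctured disc\<close>

lemma disc_kernel_denominator_bounds:
  fixes a w :: complex and R :: real
  assumes "cmod a < R" "cmod w < R"
  shows "R * (R - cmod a) \<le> cmod (R\<^sup>2 - a * cnj w)" "R\<^sup>2 - a * cnj w \<noteq> 0"
proof -
  have "0 < R" using assms(1) norm_ge_zero[of a] by linarith
  have "R\<^sup>2 - cmod a * R \<le> R\<^sup>2 - cmod a * cmod w"
    using assms by (intro diff_left_mono mult_left_mono) auto
  also have "\<dots> = cmod (complex_of_real (R\<^sup>2)) - cmod (a * cnj w)" by (simp add: norm_mult norm_power del: of_real_power)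
  also have "\<dots> \<le> cmod (R\<^sup>2 - a * cnj w)" using norm_triangle_ineq2 by (metis of_real_power)
  finally show *: "R * (R - cmod a) \<le> cmod (R\<^sup>2 - a * cnj w)"
    by (simp add: power2_eq_square algebra_simps)
  have "0 < R * (R - cmod a)" using \<open>0 < R\<close> assms by simp
  with * show "R\<^sup>2 - a * cnj w \<noteq> 0" by auto
qed

text \<open>After averaging over rotations the integrand is the radial function
  \<open>s \<mapsto> g (\<zeta> s) + \<zeta> s * deriv g (\<zeta> s)\<close> of \<open>s = |w|\<^sup>2\<close>, where \<open>\<zeta> s = a s / R\<^sup>2\<close>. It has the primitive
  \<open>s \<mapsto> s g (\<zeta> s)\<close>, whose increment over \<open>[0, R\<^sup>2]\<close> is \<open>R\<^sup>2 g a\<close>. Working on open discs with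
  a merely integrable \<open>g\<close> causes no boundary problem, because \<open>\<zeta>\<close> stays in the disc of
  radius \<open>|a| < R\<close>.\<close>

theorem disc_reproducing:
  fixes g :: "complex \<Rightarrow> complex" and a :: complex and R :: real
  assumes g: "g holomorphic_on ball 0 R" and int: "set_integrable lborel (ball 0 R) g"
    and a: "cmod a < R"
  shows "(LINT w:ball 0 R|lborel. g w / (R\<^sup>2 - a * cnj w)\<^sup>2) = pi * g a / R\<^sup>2"
proof -
  have R: "R > 0" using a norm_ge_zero[of a] by linarith
  define d where "d = R * (R - cmod a)"
  have d: "d > 0" using a R by (simp add: d_def)
  have gcont: "continuous_on (ball 0 R) g" using g by (rule holomorphic_on_imp_continuous_on)
  have g'cont: "continuous_on (ball 0 R) (deriv g)"
    using g by (intro holomorphic_on_imp_continuous_on holomorphic_deriv) auto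
  have "set_integrable lborel (ball 0 R) (\<lambda>w. (1 / (R\<^sup>2 - a * cnj w)\<^sup>2) * g w)"
  proof (rule set_integrable_bounded_mult[OF int, where B = "1 / d\<^sup>2"])
    show "continuous_on (ball 0 R) (\<lambda>w. 1 / (R\<^sup>2 - a * cnj w)\<^sup>2)"
      using disc_kernel_denominator_bounds(2)[OF a] by (intro continuous_intros) auto
    show "cmod (1 / (R\<^sup>2 - a * cnj w)\<^sup>2) \<le> 1 / d\<^sup>2" if "w \<in> ball 0 R" for w
    proof -
      have "d \<le> cmod (R\<^sup>2 - a * cnj w)"
        using disc_kernel_denominator_bounds(1)[OF a, of w] that by (simp add: d_def)
      then have "d\<^sup>2 \<le> (cmod (R\<^sup>2 - a * cnj w))\<^sup>2" using d by (intro power_mono) auto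
      then show ?thesis using d
        by (simp add: norm_divide norm_power frac_le)
    qed
  qed simp
  then have I: "set_integrable lborel (ball 0 R) (\<lambda>w. g w / (R\<^sup>2 - a * cnj w)\<^sup>2)" by simp
  define \<zeta> where "\<zeta> = (\<lambda>s::real. a * complex_of_real (s / R\<^sup>2))"
  have \<zeta>: "\<zeta> s \<in> ball 0 R" if "s \<in> {0..R\<^sup>2}" for s
  proof -
    have "cmod (\<zeta> s) = cmod a * (s / R\<^sup>2)" using that by (simp add: \<zeta>_def norm_mult norm_divide norm_power)
    also have "\<dots> \<le> cmod a * 1" using that R by (intro mult_left_mono) auto
    finally show ?thesis using a by simp
  qed
  define \<psi> where "\<psi> = (\<lambda>s. g (\<zeta> s) + \<zeta> s * deriv g (\<zeta> s))"
  have \<zeta>cont: "continuous_on X \<zeta>" for X unfolding \<zeta>_def by (intro continuous_intros) (use R in auto)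
  have \<psi>cont: "continuous_on {0..R\<^sup>2} \<psi>"
    unfolding \<psi>_def using \<zeta>
    by (intro continuous_intros \<zeta>cont continuous_on_compose2[OF gcont] continuous_on_compose2[OF g'cont]) auto
  (* The cut-off makes the radial profile Borel measurable on the whole line. *)
  define \<phi> where "\<phi> = (\<lambda>s. indicator {0..R\<^sup>2} s *\<^sub>R \<psi> s)"
  have \<phi>: "\<phi> \<in> borel_measurable borel"
    unfolding \<phi>_def using \<psi>cont by (intro borel_measurable_continuous_on_indicator) auto
  have FTC: "(LINT s:{0..R\<^sup>2}|lborel. \<phi> s) = R\<^sup>2 * g a"
  proof -
    have "(LINT s:{0..R\<^sup>2}|lborel. \<phi> s) = (\<integral>s. indicator {0..R\<^sup>2} s *\<^sub>R \<psi> s \<partial>lborel)"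
      unfolding set_lebesgue_integral_def \<phi>_def
      by (intro Bochner_Integration.integral_cong) (auto simp: indicator_def)
    also have "\<dots> = of_real (R\<^sup>2) * g (\<zeta> (R\<^sup>2)) - of_real 0 * g (\<zeta> 0)"
    proof (rule integral_FTC_atLeastAtMost)
      fix s assume "0 \<le> s" "s \<le> R\<^sup>2"
      then have "(g has_field_derivative deriv g (\<zeta> s)) (at (\<zeta> s))"
        using \<zeta>[of s] g by (intro holomorphic_derivI[where S = "ball 0 R"]) auto
      moreover have "(\<zeta> has_vector_derivative (a / R\<^sup>2)) (at s within {0..R\<^sup>2})"
        unfolding \<zeta>_def using R
        by (auto intro!: derivative_eq_intros
            simp: has_vector_derivative_def scaleR_conv_of_real fun_eq_iff power2_eq_square power4_eq_xxxx)
      ultimately have "((\<lambda>s. g (\<zeta> s)) has_vector_derivative (a / R\<^sup>2) * deriv g (\<zeta> s)) (at s within {0..R\<^sup>2})"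
        by (rule field_vector_diff_chain_within[unfolded o_def, rotated, OF has_field_derivative_at_within])
      then have "((\<lambda>s. of_real s * g (\<zeta> s)) has_vector_derivative
          (of_real s * ((a / R\<^sup>2) * deriv g (\<zeta> s)) + of_real 1 * g (\<zeta> s))) (at s within {0..R\<^sup>2})"
        by (intro has_vector_derivative_mult has_vector_derivative_of_real DERIV_ident)
      then show "((\<lambda>s. of_real s * g (\<zeta> s)) has_vector_derivative \<psi> s) (at s within {0..R\<^sup>2})"
        by (simp add: \<psi>_def \<zeta>_def mult_ac add_ac)
    qed (use \<psi>cont in auto)
    finally show ?thesis using R by (simp add: \<zeta>_def)
  qed
  have "2 * complex_of_real pi * (LINT w:ball 0 R|lborel. g w / (R\<^sup>2 - a * cnj w)\<^sup>2) =
    (LINT w:ball 0 R|lborel. LINT \<theta>:{0..2 * pi}|lborel. g (cis \<theta> * w) / (R\<^sup>2 - a * cnj (cis \<theta> * w))\<^sup>2)"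
    by (rule integral_disc_rotation_average[OF I])
  also have "\<dots> = (LINT w:ball (0::complex) R|lborel. 2 * complex_of_real pi / R ^ 4 * \<phi> ((cmod w)\<^sup>2))"
  proof (rule set_lebesgue_integral_cong, simp, safe)
    fix w :: complex assume "w \<in> ball 0 R"
    then have w: "cmod w < R" by simp
    then have "(cmod w)\<^sup>2 \<le> R\<^sup>2" by (intro power_mono) auto
    then show "(LINT \<theta>:{0..2 * pi}|lborel. g (cis \<theta> * w) / (R\<^sup>2 - a * cnj (cis \<theta> * w))\<^sup>2) =
        2 * complex_of_real pi / R ^ 4 * \<phi> ((cmod w)\<^sup>2)"
      unfolding circle_average_bergman[OF R g a w] by (simp add: \<phi>_def \<psi>_def \<zeta>_def)
  qed
  also have "\<dots> = complex_of_real pi * (LINT s:{0..R\<^sup>2}|lborel. 2 * complex_of_real pi / R ^ 4 * \<phi> s)"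
    using \<phi> by (intro integral_disc_radial R) auto
  also have "\<dots> = 2 * complex_of_real pi * (pi * g a / R\<^sup>2)"
    using R by (simp add: FTC) (simp add: power2_eq_square power4_eq_xxxx)
  finally show ?thesis by (simp only: mult_cancel_left) simp
qed

lemma set_integrable_of_square:
  fixes f :: "'a::euclidean_space \<Rightarrow> complex"
  assumes f: "continuous_on A f" and A: "A \<in> sets borel" "emeasure lborel A < \<infinity>"
    and sq: "set_integrable lborel A (\<lambda>x. (cmod (f x))\<^sup>2)"
  shows "set_integrable lborel A f"
  unfolding set_integrable_def
proof (rule Bochner_Integration.integrable_bound)
  show "integrable lborel (\<lambda>x. indicator A x + indicator A x *\<^sub>R (cmod (f x))\<^sup>2 :: real)"
    using sq A unfolding set_integrable_def
    by (intro Bochner_Integration.integrable_add integrable_real_indicator) auto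
  show "(\<lambda>x. indicator A x *\<^sub>R f x) \<in> borel_measurable lborel"
    using borel_measurable_continuous_on_indicator[OF A(1) f] by simp
  have "t \<le> 1 + t\<^sup>2" for t :: real
    using zero_le_power2[of "t - 1 / 2"] by (simp add: power2_eq_square algebra_simps)
  then show "AE x in lborel. norm (indicator A x *\<^sub>R f x) \<le>
      norm (indicator A x + indicator A x *\<^sub>R (cmod (f x))\<^sup>2 :: real)"
    by (intro AE_I2) (auto simp: indicator_def)
qed

text \<open>The reproducing formula for the integrable holomorphic function \<open>g\<^sup>2\<close>, with the kernel
  estimated by its supremum. For \<open>a = 0\<close> this is the sub-mean-value inequality.\<close>

lemma disc_point_evaluation_bound:
  fixes g :: "complex \<Rightarrow> complex" and a :: complex and R :: real
  assumes g: "g holomorphic_on ball 0 R" and sq: "set_integrable lborel (ball 0 R) (\<lambda>w. (cmod (g w))\<^sup>2)"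
    and a: "cmod a < R"
  shows "pi * (R - cmod a)\<^sup>2 * (cmod (g a))\<^sup>2 \<le> (LINT w:ball 0 R|lborel. (cmod (g w))\<^sup>2)"
proof -
  have R: "R > 0" using a norm_ge_zero[of a] by linarith
  define d where "d = R * (R - cmod a)"
  have d: "d > 0" using a R by (simp add: d_def)
  have gc: "continuous_on (ball 0 R) g" using g by (rule holomorphic_on_imp_continuous_on)
  have meas: "(\<lambda>w. indicator (ball 0 R) w *\<^sub>R (g w)\<^sup>2) \<in> borel_measurable borel"
    by (intro borel_measurable_continuous_on_indicator continuous_intros gc) auto
  have int: "set_integrable lborel (ball 0 R) (\<lambda>w. (g w)\<^sup>2)"
    unfolding set_integrable_def
    by (rule Bochner_Integration.integrable_bound[OF sq[unfolded set_integrable_def]])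
       (use meas in \<open>auto simp: norm_power\<close>)
  have "(LINT w:ball 0 R|lborel. (g w)\<^sup>2 / (R\<^sup>2 - a * cnj w)\<^sup>2) = pi * (g a)\<^sup>2 / R\<^sup>2"
    using g by (intro disc_reproducing int a holomorphic_intros)
  then have "pi * (cmod (g a))\<^sup>2 / R\<^sup>2 = cmod (LINT w:ball 0 R|lborel. (g w)\<^sup>2 / (R\<^sup>2 - a * cnj w)\<^sup>2)"
    by (simp add: norm_mult norm_divide norm_power)
  also have "\<dots> \<le> (\<integral>w. norm (indicator (ball 0 R) w *\<^sub>R ((g w)\<^sup>2 / (R\<^sup>2 - a * cnj w)\<^sup>2)) \<partial>lborel)"
    unfolding set_lebesgue_integral_def by (rule integral_norm_bound)
  also have "\<dots> \<le> (LINT w:ball 0 R|lborel. (cmod (g w))\<^sup>2 / d\<^sup>2)"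
    unfolding set_lebesgue_integral_def
  proof (rule integral_mono')
    show "integrable lborel (\<lambda>w. indicator (ball 0 R) w *\<^sub>R ((cmod (g w))\<^sup>2 / d\<^sup>2))"
      using sq unfolding set_integrable_def by auto
    show "norm (indicator (ball 0 R) w *\<^sub>R ((g w)\<^sup>2 / (R\<^sup>2 - a * cnj w)\<^sup>2)) \<le>
        indicator (ball 0 R) w *\<^sub>R ((cmod (g w))\<^sup>2 / d\<^sup>2)" for w
    proof (cases "w \<in> ball 0 R")
      case True
      then have "d \<le> cmod (R\<^sup>2 - a * cnj w)"
        using disc_kernel_denominator_bounds(1)[OF a, of w] by (simp add: d_def)
      then have "d\<^sup>2 \<le> (cmod (R\<^sup>2 - a * cnj w))\<^sup>2" using d by (intro power_mono) auto
      then show ?thesis using d True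
        by (simp add: norm_divide norm_power frac_le)
    qed simp
  qed simp
  also have "\<dots> = (LINT w:ball 0 R|lborel. (cmod (g w))\<^sup>2) / d\<^sup>2" by simp
  finally have "pi * (cmod (g a))\<^sup>2 / R\<^sup>2 * d\<^sup>2 \<le> (LINT w:ball 0 R|lborel. (cmod (g w))\<^sup>2)"
    using d by (simp add: pos_le_divide_eq)
  moreover have "d\<^sup>2 = R\<^sup>2 * (R - cmod a)\<^sup>2" by (simp add: d_def power_mult_distrib)
  ultimately show ?thesis using R by (simp add: mult_ac)
qed

text \<open>The disc of radius \<open>|v|\<close> about \<open>v\<close> avoids \<open>0\<close>, so the sub-mean-value inequality bounds
  \<open>\<pi> |v h v|\<^sup>2\<close> by the integral of \<open>|h|\<^sup>2\<close> over the punctured disc of radius \<open>2 |v|\<close>. By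
  dominated convergence these integrals vanish as \<open>v\<close> tends to \<open>0\<close>. Square-integrability is what
  rules out a simple pole: \<open>1 / v\<close> is integrable, but its square is not.\<close>

lemma punctured_disc_decay:
  fixes h :: "complex \<Rightarrow> complex"
  assumes h: "h holomorphic_on ball 0 1 - {0}"
    and sq: "set_integrable lborel (ball 0 1 - {0}) (\<lambda>w. (cmod (h w))\<^sup>2)"
  shows "((\<lambda>v. v * h v) \<longlongrightarrow> 0) (at 0)"
proof -
  define I where "I = (\<lambda>n. \<integral>w. indicator (ball 0 (1 / Suc n) - {0}) w *\<^sub>R (cmod (h w))\<^sup>2 \<partial>lborel)"
  have hc: "continuous_on (ball 0 1 - {0}) h" using h by (rule holomorphic_on_imp_continuous_on)
  have sub: "ball (0::complex) (1 / Suc n) - {0} \<subseteq> ball 0 1 - {0}" for n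
  proof -
    have "1 / real (Suc n) \<le> 1" by simp
    then show ?thesis by (intro Diff_mono subset_ball) auto
  qed
  have intS: "integrable lborel (\<lambda>w. indicator S w *\<^sub>R (cmod (h w))\<^sup>2)"
    if "S \<in> sets borel" "S \<subseteq> ball 0 1 - {0}" for S
    using set_integrable_subset[OF sq, of S] that by (simp add: set_integrable_def)
  have "I \<longlonglongrightarrow> (\<integral>w. 0 \<partial>(lborel :: complex measure))"
    unfolding I_def
  proof (rule integral_dominated_convergence)
    show "integrable lborel (\<lambda>w. indicator (ball 0 1 - {0}) w *\<^sub>R (cmod (h w))\<^sup>2)"
      by (rule intS) auto
    show "(\<lambda>w. indicator (ball 0 (1 / Suc n) - {0}) w *\<^sub>R (cmod (h w))\<^sup>2) \<in> borel_measurable lborel" for n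
      using intS[OF _ sub[of n]] by auto
    show "AE w in lborel. (\<lambda>n. indicator (ball 0 (1 / Suc n) - {0}) w *\<^sub>R (cmod (h w))\<^sup>2) \<longlonglongrightarrow> 0"
    proof (rule AE_I2)
      fix w :: complex
      show "(\<lambda>n. indicator (ball 0 (1 / Suc n) - {0}) w *\<^sub>R (cmod (h w))\<^sup>2) \<longlonglongrightarrow> 0"
      proof (cases "w = 0")
        case False
        then have "eventually (\<lambda>n. 1 / Suc n < cmod w) sequentially"
          using order_tendstoD(2)[OF LIMSEQ_inverse_real_of_nat, of "cmod w"]
          by (simp add: inverse_eq_divide)
        then have "eventually (\<lambda>n. indicator (ball 0 (1 / Suc n) - {0}) w *\<^sub>R (cmod (h w))\<^sup>2 = 0) sequentially"
          by eventually_elim (auto simp: indicator_def)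
        then show ?thesis by (rule tendsto_eventually)
      qed simp
    qed
    show "AE w in lborel. norm (indicator (ball 0 (1 / Suc n) - {0}) w *\<^sub>R (cmod (h w))\<^sup>2) \<le>
        indicator (ball 0 1 - {0}) w *\<^sub>R (cmod (h w))\<^sup>2" for n
      using sub[of n] by (intro AE_I2) (auto simp: indicator_def)
  qed simp
  then have I: "I \<longlonglongrightarrow> 0" by simp
  show ?thesis
  proof (rule tendstoI)
    fix e :: real assume e: "e > 0"
    then have "eventually (\<lambda>n. I n < pi * e\<^sup>2) sequentially"
      using order_tendstoD(2)[OF I, of "pi * e\<^sup>2"] by simp
    then obtain n where n: "I n < pi * e\<^sup>2" by (auto simp: eventually_sequentially)
    have "cmod (v * h v) < e" if v: "v \<noteq> 0" "cmod v < 1 / (2 * Suc n)" for v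
    proof -
      have bsub: "ball v (cmod v) \<subseteq> ball 0 (1 / Suc n) - {0}"
      proof
        fix w assume w: "w \<in> ball v (cmod v)"
        then have "cmod w < 2 * cmod v" using norm_triangle_sub[of w v]
          by (simp add: dist_norm norm_minus_commute)
        also have "2 * cmod v < 1 / Suc n" using v by (simp add: field_simps)
        finally have "cmod w < 1 / Suc n" .
        with w show "w \<in> ball 0 (1 / Suc n) - {0}" by (auto simp: dist_norm)
      qed
      have trans: "v + w \<in> ball v (cmod v) \<longleftrightarrow> w \<in> ball 0 (cmod v)" for w by (simp add: dist_norm)
      have ind: "indicator (ball v (cmod v)) (v + w) = (indicator (ball 0 (cmod v)) w :: real)" for w
        using trans[of w] by (simp only: indicator_def)
      have ib: "integrable lborel (\<lambda>w. indicator (ball v (cmod v)) w *\<^sub>R (cmod (h w))\<^sup>2)"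
        using bsub sub[of n] by (intro intS) auto
      then have bm: "(\<lambda>w. indicator (ball v (cmod v)) w *\<^sub>R (cmod (h w))\<^sup>2) \<in> borel_measurable borel" by auto
      have "(\<lambda>w. v + w) ` ball 0 (cmod v) \<subseteq> ball 0 1 - {0}"
        by (rule order_trans[OF _ order_trans[OF bsub sub]]) (auto simp: dist_norm)
      then have hol: "(\<lambda>w. h (v + w)) holomorphic_on ball 0 (cmod v)"
        by (rule holomorphic_on_compose_gen[OF _ h, unfolded o_def, rotated]) (intro holomorphic_intros)
      have "integrable (distr lborel borel ((+) v)) (\<lambda>w. indicator (ball v (cmod v)) w *\<^sub>R (cmod (h w))\<^sup>2)"
        using ib unfolding lborel_distr_plus .
      then have "integrable lborel (\<lambda>w. indicator (ball v (cmod v)) (v + w) *\<^sub>R (cmod (h (v + w)))\<^sup>2)"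
        by (rule integrable_distr[rotated]) simp
      then have "set_integrable lborel (ball 0 (cmod v)) (\<lambda>w. (cmod (h (v + w)))\<^sup>2)"
        unfolding set_integrable_def ind .
      from disc_point_evaluation_bound[OF hol this, of 0]
      have "pi * (cmod v)\<^sup>2 * (cmod (h v))\<^sup>2 \<le> (LINT w:ball 0 (cmod v)|lborel. (cmod (h (v + w)))\<^sup>2)"
        using v by simp
      also have "\<dots> = (\<integral>w. indicator (ball v (cmod v)) w *\<^sub>R (cmod (h w))\<^sup>2 \<partial>distr lborel borel ((+) v))"
        unfolding set_lebesgue_integral_def
        by (subst integral_distr) (use bm in \<open>auto simp: ind\<close>)
      also have "\<dots> = (\<integral>w. indicator (ball v (cmod v)) w *\<^sub>R (cmod (h w))\<^sup>2 \<partial>lborel)"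
        by (simp add: lborel_distr_plus)
      also have "\<dots> \<le> I n"
        unfolding I_def
        by (rule integral_mono'[OF intS[OF _ sub]]) (use bsub in \<open>auto simp: indicator_def\<close>)
      finally have "pi * (cmod (v * h v))\<^sup>2 \<le> I n"
        by (simp add: norm_mult power_mult_distrib mult.assoc)
      then have "pi * (cmod (v * h v))\<^sup>2 < pi * e\<^sup>2" using n by (rule le_less_trans)
      then have "(cmod (v * h v))\<^sup>2 < e\<^sup>2" by simp
      then show ?thesis using e by (simp add: power_less_imp_less_base)
    qed
    then show "eventually (\<lambda>v. dist (v * h v) 0 < e) (at 0)"
      unfolding eventually_at by (intro exI[of _ "1 / (2 * Suc n)"]) auto
  qed
qed

text \<open>By the decay at \<open>0\<close> and Riemann's theorem on removable singularities, \<open>h\<close> extends to the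
  disc; the puncture is a null set, so the formula for the disc applies to the extension.\<close>

theorem punctured_disc_reproducing:
  fixes h :: "complex \<Rightarrow> complex" and a :: complex
  assumes h: "h holomorphic_on ball 0 1 - {0}"
    and sq: "set_integrable lborel (ball 0 1 - {0}) (\<lambda>w. (cmod (h w))\<^sup>2)"
    and a: "a \<noteq> 0" "cmod a < 1"
  shows "(LINT w:ball 0 1 - {0}|lborel. h w / (1 - a * cnj w)\<^sup>2) = pi * h a"
proof -
  have "\<exists>g. g holomorphic_on ball 0 1 \<and> (\<forall>z\<in>ball 0 1 - {0}. g z = h z)"
    using punctured_disc_decay[OF h sq] by (subst holomorphic_on_extend_lim[OF h]) (auto simp: interior_open)
  then obtain g where g: "g holomorphic_on ball 0 1" and gh: "\<And>z. z \<in> ball 0 1 - {0} \<Longrightarrow> g z = h z"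
    by blast
  have AE0: "AE w in lborel. w \<noteq> (0::complex)" by (rule AE_lborel_singleton)
  have gc: "continuous_on (ball 0 1) g" using g by (rule holomorphic_on_imp_continuous_on)
  have "set_integrable lborel (ball 0 1) (\<lambda>w. (cmod (g w))\<^sup>2)"
    unfolding set_integrable_def
  proof (rule integrable_cong_AE_imp[OF sq[unfolded set_integrable_def]])
    show "(\<lambda>w. indicator (ball 0 1) w *\<^sub>R (cmod (g w))\<^sup>2) \<in> borel_measurable lborel"
      using borel_measurable_continuous_on_indicator[of "ball 0 1" "\<lambda>w. (cmod (g w))\<^sup>2"] gc
      by (simp add: continuous_on_power continuous_on_norm)
    show "AE w in lborel. indicator (ball 0 1 - {0}) w *\<^sub>R (cmod (h w))\<^sup>2 =
        indicator (ball 0 1) w *\<^sub>R (cmod (g w))\<^sup>2"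
      using AE0 by eventually_elim (auto simp: indicator_def gh)
  qed
  then have gi: "set_integrable lborel (ball 0 1) g"
    by (intro set_integrable_of_square gc) (auto simp: emeasure_ball)
  have "(LINT w:ball 0 1 - {0}|lborel. h w / (1 - a * cnj w)\<^sup>2) =
      (LINT w:ball 0 1 - {0}|lborel. g w / (1 - a * cnj w)\<^sup>2)"
    by (intro set_lebesgue_integral_cong) (auto simp: gh)
  also have "\<dots> = (LINT w:ball 0 1|lborel. g w / (1 - a * cnj w)\<^sup>2)"
    unfolding set_lebesgue_integral_def
  proof (rule integral_cong_AE)
    have q: "continuous_on (ball 0 1) (\<lambda>w. g w / (1 - a * cnj w)\<^sup>2)"
      using disc_kernel_denominator_bounds(2)[of a 1] a by (intro continuous_intros gc) auto
    then show "(\<lambda>w. indicator (ball 0 1) w *\<^sub>R (g w / (1 - a * cnj w)\<^sup>2)) \<in> borel_measurable lborel"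
      using borel_measurable_continuous_on_indicator[OF _ q] by simp
    have "continuous_on (ball 0 1 - {0}) (\<lambda>w. g w / (1 - a * cnj w)\<^sup>2)"
      by (rule continuous_on_subset[OF q]) auto
    then show "(\<lambda>w. indicator (ball 0 1 - {0}) w *\<^sub>R (g w / (1 - a * cnj w)\<^sup>2)) \<in> borel_measurable lborel"
      using borel_measurable_continuous_on_indicator[of "ball 0 1 - {0}"] by simp
    show "AE w in lborel. indicator (ball 0 1 - {0}) w *\<^sub>R (g w / (1 - a * cnj w)\<^sup>2) =
        indicator (ball 0 1) w *\<^sub>R (g w / (1 - a * cnj w)\<^sup>2)"
      using AE0 by eventually_elim (auto simp: indicator_def)
  qed
  also have "\<dots> = pi * g a"
    using disc_reproducing[OF g gi a(2)] by simp
  finally show ?thesis using gh[of a] a by simp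
qed

section \<open>Holomorphic functions of several variables and Bergman spaces\<close>

lemma holomorphic_vec_on_imp_continuous_on:
  assumes "holomorphic_vec_on f S"
  shows "continuous_on S f"
  using assms unfolding holomorphic_vec_on_def
  by (blast intro: continuous_at_imp_continuous_on has_derivative_continuous)

lemma holomorphic_vec_on_const: "holomorphic_vec_on (\<lambda>_. c) S"
  unfolding holomorphic_vec_on_def by (auto intro!: exI[of _ "\<lambda>_. 0"])

lemma holomorphic_vec_on_nth: "holomorphic_vec_on (\<lambda>z. z $ i) S"
  unfolding holomorphic_vec_on_def
  by (auto intro!: exI[of _ "\<lambda>z. z $ i"] bounded_linear_imp_has_derivative)

lemma holomorphic_vec_on_diff:
  assumes "holomorphic_vec_on f S" "holomorphic_vec_on g S"
  shows "holomorphic_vec_on (\<lambda>z. f z - g z) S"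
  unfolding holomorphic_vec_on_def
proof
  fix z assume "z \<in> S"
  then obtain D E where "(f has_derivative D) (at z)" "\<forall>c v. D (c *s v) = c * D v"
    "(g has_derivative E) (at z)" "\<forall>c v. E (c *s v) = c * E v"
    using assms unfolding holomorphic_vec_on_def by metis
  then show "\<exists>D. ((\<lambda>z. f z - g z) has_derivative D) (at z) \<and> (\<forall>c v. D (c *s v) = c * D v)"
    by (intro exI[of _ "\<lambda>v. D v - E v"]) (auto intro!: has_derivative_diff simp: algebra_simps)
qed

lemma holomorphic_vec_on_mult:
  assumes "holomorphic_vec_on f S" "holomorphic_vec_on g S"
  shows "holomorphic_vec_on (\<lambda>z. f z * g z) S"
  unfolding holomorphic_vec_on_def
proof
  fix z assume "z \<in> S"
  then obtain D E where "(f has_derivative D) (at z)" "\<forall>c v. D (c *s v) = c * D v"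
    "(g has_derivative E) (at z)" "\<forall>c v. E (c *s v) = c * E v"
    using assms unfolding holomorphic_vec_on_def by metis
  then show "\<exists>D. ((\<lambda>z. f z * g z) has_derivative D) (at z) \<and> (\<forall>c v. D (c *s v) = c * D v)"
    by (intro exI[of _ "\<lambda>v. f z * E v + D v * g z"] conjI has_derivative_mult)
       (auto simp: algebra_simps)
qed

lemma holomorphic_vec_on_power:
  assumes "holomorphic_vec_on f S"
  shows "holomorphic_vec_on (\<lambda>z. f z ^ n) S"
  by (induction n) (auto intro: holomorphic_vec_on_const holomorphic_vec_on_mult assms)

lemma holomorphic_vec_on_divide:
  assumes "holomorphic_vec_on f S" "holomorphic_vec_on g S" "\<And>z. z \<in> S \<Longrightarrow> g z \<noteq> 0"
  shows "holomorphic_vec_on (\<lambda>z. f z / g z) S"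
proof -
  have "holomorphic_vec_on (\<lambda>z. inverse (g z)) S"
    unfolding holomorphic_vec_on_def
  proof
    fix z assume z: "z \<in> S"
    then obtain E where "(g has_derivative E) (at z)" "\<forall>c v. E (c *s v) = c * E v"
      using assms(2) unfolding holomorphic_vec_on_def by metis
    then show "\<exists>D. ((\<lambda>z. inverse (g z)) has_derivative D) (at z) \<and> (\<forall>c v. D (c *s v) = c * D v)"
      using assms(3)[OF z]
      by (intro exI[of _ "\<lambda>v. - (inverse (g z) * E v * inverse (g z))"])
         (auto intro!: has_derivative_inverse)
  qed
  then show ?thesis
    unfolding divide_inverse by (intro holomorphic_vec_on_mult assms)
qed

lemma holomorphic_vec_on_cong:
  assumes "open S" "\<And>z. z \<in> S \<Longrightarrow> f z = g z"
  shows "holomorphic_vec_on f S \<longleftrightarrow> holomorphic_vec_on g S"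
  unfolding holomorphic_vec_on_def
  by (intro ball_cong refl) (metis assms has_derivative_transform_within_open)

text \<open>The chain rule along a holomorphic curve. Complex homogeneity of the derivative of \<open>f\<close> is exactly what
  turns the real derivative of the composite into multiplication by a complex number. Both slices of
  the Hartogs triangle and curves inside it are handled by this lemma.\<close>

lemma holomorphic_on_compose_vec2:
  assumes f: "holomorphic_vec_on f \<Omega>" and p: "p holomorphic_on S" and q: "q holomorphic_on S"
    and S: "open S" and \<Omega>: "\<And>x. x \<in> S \<Longrightarrow> vec2 (p x) (q x) \<in> \<Omega>"
  shows "(\<lambda>x. f (vec2 (p x) (q x))) holomorphic_on S"
proof -
  have "\<exists>d. ((\<lambda>x. f (vec2 (p x) (q x))) has_field_derivative d) (at x)" if x: "x \<in> S" for x
  proof -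
    have l1: "bounded_linear (\<lambda>a. vec2 a (0::complex))" and l2: "bounded_linear (\<lambda>b. vec2 (0::complex) b)"
      unfolding linear_conv_bounded_linear[symmetric]
      by (auto intro!: linearI simp: vec_eq_iff forall_2)
    have sp: "vec2 a b = vec2 a 0 + vec2 0 b" for a b :: complex by (simp add: vec_eq_iff forall_2)
    from \<Omega>[OF x] f obtain D where D: "(f has_derivative D) (at (vec2 (p x) (q x)))"
      and lin: "\<And>c v. D (c *s v) = c * D v"
      unfolding holomorphic_vec_on_def by metis
    have "(p has_derivative (\<lambda>h. deriv p x * h)) (at x)" "(q has_derivative (\<lambda>h. deriv q x * h)) (at x)"
      using holomorphic_derivI[OF p S x] holomorphic_derivI[OF q S x]
      by (auto simp: has_field_derivative_def)
    then have "((\<lambda>x. vec2 (p x) 0 + vec2 0 (q x)) has_derivative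
        (\<lambda>h. vec2 (deriv p x * h) 0 + vec2 0 (deriv q x * h))) (at x)"
      by (intro has_derivative_add bounded_linear.has_derivative[OF l1] bounded_linear.has_derivative[OF l2])
    then have "((\<lambda>x. vec2 (p x) (q x)) has_derivative (\<lambda>h. vec2 (deriv p x * h) (deriv q x * h))) (at x)"
      by (simp flip: sp)
    from has_derivative_compose[OF this D]
    have "((\<lambda>x. f (vec2 (p x) (q x))) has_derivative (\<lambda>h. D (vec2 (deriv p x * h) (deriv q x * h)))) (at x)" .
    moreover have "vec2 (deriv p x * h) (deriv q x * h) = h *s vec2 (deriv p x) (deriv q x)" for h
      by (simp add: vec_eq_iff forall_2)
    ultimately have "((\<lambda>x. f (vec2 (p x) (q x))) has_derivative
        (\<lambda>h. D (vec2 (deriv p x) (deriv q x)) * h)) (at x)"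
      by (simp add: lin mult.commute)
    then show ?thesis by (auto simp: has_field_derivative_def)
  qed
  then show ?thesis using S by (simp add: holomorphic_on_open)
qed

lemma bergman_space_measurable:
  assumes "open \<Omega>" "f \<in> bergman_space \<Omega>"
  shows "(\<lambda>z. indicator \<Omega> z *\<^sub>R f z) \<in> borel_measurable borel"
  using assms holomorphic_vec_on_imp_continuous_on
  by (intro borel_measurable_continuous_on_indicator) (auto simp: bergman_space_def)

lemma bergman_space_mult_integrable:
  assumes \<Omega>: "open \<Omega>" and f: "(\<lambda>w. cnj (f w)) \<in> bergman_space \<Omega>" and g: "g \<in> bergman_space \<Omega>"
  shows "set_integrable lborel \<Omega> (\<lambda>z. f z * g z)"
  unfolding set_integrable_def
proof (rule Bochner_Integration.integrable_bound)
  show "integrable lborel (\<lambda>z. indicator \<Omega> z *\<^sub>R (cmod (f z))\<^sup>2 + indicator \<Omega> z *\<^sub>R (cmod (g z))\<^sup>2)"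
    using f g by (intro Bochner_Integration.integrable_add) (auto simp: bergman_space_def set_integrable_def)
  have "(\<lambda>z. cnj (indicator \<Omega> z *\<^sub>R cnj (f z)) * (indicator \<Omega> z *\<^sub>R g z)) \<in> borel_measurable borel"
    using bergman_space_measurable[OF \<Omega> f] bergman_space_measurable[OF \<Omega> g]
    by (intro borel_measurable_times borel_measurable_continuous_on[of cnj] continuous_intros)
  also have "(\<lambda>z. cnj (indicator \<Omega> z *\<^sub>R cnj (f z)) * (indicator \<Omega> z *\<^sub>R g z)) =
      (\<lambda>z. indicator \<Omega> z *\<^sub>R (f z * g z))" by (auto simp: indicator_def)
  finally show "(\<lambda>z. indicator \<Omega> z *\<^sub>R (f z * g z)) \<in> borel_measurable lborel" by simp
  have "x * y \<le> x\<^sup>2 + y\<^sup>2" if "x \<ge> 0" "y \<ge> 0" for x y :: real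
    using sum_squares_bound[of x y] that mult_nonneg_nonneg[of x y] by linarith
  then show "AE z in lborel. norm (indicator \<Omega> z *\<^sub>R (f z * g z)) \<le>
      norm (indicator \<Omega> z *\<^sub>R (cmod (f z))\<^sup>2 + indicator \<Omega> z *\<^sub>R (cmod (g z))\<^sup>2)"
    by (intro AE_I2) (auto simp: indicator_def norm_mult)
qed

lemma bergman_space_diff:
  assumes \<Omega>: "open \<Omega>" and f: "f \<in> bergman_space \<Omega>" and g: "g \<in> bergman_space \<Omega>"
  shows "(\<lambda>z. f z - g z) \<in> bergman_space \<Omega>"
  unfolding bergman_space_def
proof (intro CollectI conjI)
  show "holomorphic_vec_on (\<lambda>z. f z - g z) \<Omega>"
    using f g by (auto simp: bergman_space_def intro: holomorphic_vec_on_diff)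
  show "set_integrable lborel \<Omega> (\<lambda>z. (cmod (f z - g z))\<^sup>2)"
    unfolding set_integrable_def
  proof (rule Bochner_Integration.integrable_bound)
    show "integrable lborel (\<lambda>z. 2 *\<^sub>R (indicator \<Omega> z *\<^sub>R (cmod (f z))\<^sup>2) + 2 *\<^sub>R (indicator \<Omega> z *\<^sub>R (cmod (g z))\<^sup>2))"
      using f g by (intro Bochner_Integration.integrable_add integrable_scaleR_right)
        (auto simp: bergman_space_def set_integrable_def)
    have "(\<lambda>z. (norm (indicator \<Omega> z *\<^sub>R f z - indicator \<Omega> z *\<^sub>R g z))\<^sup>2) \<in> borel_measurable borel"
      using bergman_space_measurable[OF \<Omega> f] bergman_space_measurable[OF \<Omega> g] by measurable
    also have "(\<lambda>z. (norm (indicator \<Omega> z *\<^sub>R f z - indicator \<Omega> z *\<^sub>R g z))\<^sup>2) =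
        (\<lambda>z. indicator \<Omega> z *\<^sub>R (cmod (f z - g z))\<^sup>2)" by (auto simp: indicator_def)
    finally show "(\<lambda>z. indicator \<Omega> z *\<^sub>R (cmod (f z - g z))\<^sup>2) \<in> borel_measurable lborel" by simp
    have "(cmod (x - y))\<^sup>2 \<le> 2 * (cmod x)\<^sup>2 + 2 * (cmod y)\<^sup>2" for x y
    proof -
      have "(cmod (x - y))\<^sup>2 \<le> (cmod x + cmod y)\<^sup>2" by (intro power_mono norm_triangle_ineq4) auto
      also have "\<dots> \<le> 2 * (cmod x)\<^sup>2 + 2 * (cmod y)\<^sup>2"
        using sum_squares_bound[of "cmod x" "cmod y"] by (simp add: power2_sum)
      finally show ?thesis .
    qed
    then show "AE z in lborel. norm (indicator \<Omega> z *\<^sub>R (cmod (f z - g z))\<^sup>2) \<le>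
        norm (2 *\<^sub>R (indicator \<Omega> z *\<^sub>R (cmod (f z))\<^sup>2) + 2 *\<^sub>R (indicator \<Omega> z *\<^sub>R (cmod (g z))\<^sup>2))"
      by (intro AE_I2) (auto simp: indicator_def)
  qed
qed

lemma bergman_space_norm_zero_imp_zero:
  assumes \<Omega>: "open \<Omega>" and f: "f \<in> bergman_space \<Omega>"
    and zero: "(LINT z:\<Omega>|lborel. (cmod (f z))\<^sup>2) = 0" and z: "z \<in> \<Omega>"
  shows "f z = 0"
proof (rule ccontr)
  assume nz: "f z \<noteq> 0"
  have "continuous_on \<Omega> f"
    using f by (auto simp: bergman_space_def intro: holomorphic_vec_on_imp_continuous_on)
  then have op: "open (\<Omega> \<inter> f -` (- {0}))"
    using \<Omega> by (intro continuous_open_preimage) auto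
  have "AE x in lborel. indicator \<Omega> x *\<^sub>R (cmod (f x))\<^sup>2 = 0"
    using zero f unfolding set_lebesgue_integral_def
    by (subst (asm) integral_nonneg_eq_0_iff_AE) (auto simp: bergman_space_def set_integrable_def)
  then have "AE x in lborel. x \<notin> \<Omega> \<inter> f -` (- {0})"
    by eventually_elim (auto simp: indicator_def)
  then have "negligible (\<Omega> \<inter> f -` (- {0}))"
    using op unfolding negligible_iff_null_sets
    by (intro null_sets_completionI) (simp add: AE_iff_null_sets)
  moreover have "\<Omega> \<inter> f -` (- {0}) \<noteq> {}" using z nz by auto
  ultimately show False using op open_not_negligible by blast
qed

text \<open>If \<open>B\<close> and \<open>B'\<close> both reproduce, then \<open>f = cnj (B' z w) - cnj (B z w)\<close>, as a function of \<open>w\<close>, lies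
  in the Bergman space; reproducing \<open>f z\<close> with either kernel and subtracting shows that \<open>|f|\<^sup>2\<close> has
  integral zero, so \<open>f\<close> vanishes by continuity.\<close>

theorem bergman_kernel_eqI:
  assumes \<Omega>: "open \<Omega>" and B: "is_bergman_kernel \<Omega> B"
    and off: "\<And>z w. z \<notin> \<Omega> \<or> w \<notin> \<Omega> \<Longrightarrow> B z w = 0"
  shows "bergman_kernel \<Omega> = B"
  unfolding bergman_kernel_def
proof (rule the_equality)
  show "is_bergman_kernel \<Omega> B \<and> (\<forall>z w. z \<notin> \<Omega> \<or> w \<notin> \<Omega> \<longrightarrow> B z w = 0)"
    using B off by blast
next
  fix B' assume B': "is_bergman_kernel \<Omega> B' \<and> (\<forall>z w. z \<notin> \<Omega> \<or> w \<notin> \<Omega> \<longrightarrow> B' z w = 0)"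
  show "B' = B"
  proof (intro ext)
    fix z w
    show "B' z w = B z w"
    proof (cases "z \<in> \<Omega> \<and> w \<in> \<Omega>")
      case True
      have cB: "(\<lambda>w. cnj (B z w)) \<in> bergman_space \<Omega>" and cB': "(\<lambda>w. cnj (B' z w)) \<in> bergman_space \<Omega>"
        using B B' True unfolding is_bergman_kernel_def by blast+
      define f where "f = (\<lambda>w. cnj (B' z w) - cnj (B z w))"
      have f: "f \<in> bergman_space \<Omega>"
        unfolding f_def by (rule bergman_space_diff[OF \<Omega> cB' cB])
      have "(LINT w:\<Omega>|lborel. B' z w * f w) = (LINT w:\<Omega>|lborel. B z w * f w)"
        using B B' True f unfolding is_bergman_kernel_def by metis
      then have "0 = (LINT w:\<Omega>|lborel. B' z w * f w - B z w * f w)"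
        using bergman_space_mult_integrable[OF \<Omega> cB' f] bergman_space_mult_integrable[OF \<Omega> cB f]
        by (subst set_integral_diff) auto
      also have "(\<lambda>w. B' z w * f w - B z w * f w) = (\<lambda>w. complex_of_real ((cmod (f w))\<^sup>2))"
        unfolding f_def by (auto simp: complex_norm_square algebra_simps simp del: of_real_power)
      also have "(LINT w:\<Omega>|lborel. complex_of_real ((cmod (f w))\<^sup>2)) =
          complex_of_real (LINT w:\<Omega>|lborel. (cmod (f w))\<^sup>2)"
        by (rule set_integral_complex_of_real)
      finally have "(LINT w:\<Omega>|lborel. (cmod (f w))\<^sup>2) = 0" by simp
      then have "f w = 0" using True by (intro bergman_space_norm_zero_imp_zero[OF \<Omega> f]) auto
      then show ?thesis by (simp add: f_def)
    qed (use off B' in auto)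
  qed
qed

section \<open>The Hartogs triangle with exponent the reciprocal of a positive integer\<close>

lemma hartogs_triangle_inverse_nat:
  assumes "k > 0"
  shows "hartogs_triangle (1 / real k) = {z. cmod (z $ 1) < cmod (z $ 2) ^ k \<and> cmod (z $ 2) < 1}"
proof -
  have "x powr (1 / real k) < y \<longleftrightarrow> x < y ^ k" if "x \<ge> 0" "y \<ge> 0" for x y :: real
  proof -
    have "(x powr (1 / real k)) ^ k = x"
      using that(1) assms by (cases "x = 0") (auto simp: powr_powr simp flip: powr_realpow)
    moreover have "x powr (1 / real k) < y \<longleftrightarrow> (x powr (1 / real k)) ^ k < y ^ k"
      using that(2) assms by (metis power_less_imp_less_base power_strict_mono powr_ge_zero)
    ultimately show ?thesis by simp
  qed
  then show ?thesis by (auto simp: hartogs_triangle_def)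
qed

definition hartogs_kernel :: "nat \<Rightarrow> complex ^ 2 \<Rightarrow> complex ^ 2 \<Rightarrow> complex" where
  "hartogs_kernel k z w = (let s = z $ 1 * cnj (w $ 1); t = z $ 2 * cnj (w $ 2)
     in t ^ k / ((complex_of_real pi)\<^sup>2 * (1 - t)\<^sup>2 * (t ^ k - s)\<^sup>2))"

context
  fixes k :: nat and \<Omega> :: "(complex ^ 2) set"
  assumes k: "k > 0"
  defines "\<Omega> \<equiv> hartogs_triangle (1 / real k)"
begin

lemma hartogs_mem_iff: "z \<in> \<Omega> \<longleftrightarrow> cmod (z $ 1) < cmod (z $ 2) ^ k \<and> cmod (z $ 2) < 1"
  by (simp add: \<Omega>_def hartogs_triangle_inverse_nat[OF k])

lemma hartogs_snd_nonzero: "z \<in> \<Omega> \<Longrightarrow> z $ 2 \<noteq> 0"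
  using k by (auto simp: hartogs_mem_iff power_0_left not_less[symmetric])

lemma hartogs_ratio_less_one: "z \<in> \<Omega> \<Longrightarrow> cmod (z $ 1 / z $ 2 ^ k) < 1"
  using hartogs_snd_nonzero[of z] by (simp add: hartogs_mem_iff norm_divide norm_power)

lemma open_hartogs: "open \<Omega>"
proof -
  have "\<Omega> = {z. cmod (z $ 1) < cmod (z $ 2) ^ k} \<inter> {z. cmod (z $ 2) < 1}"
    by (auto simp: hartogs_mem_iff)
  also have "open \<dots>"
    by (intro open_Int open_Collect_less continuous_intros)
  finally show ?thesis .
qed

lemma vec2_mem_hartogs:
  "vec2 u v \<in> \<Omega> \<longleftrightarrow> v \<in> ball 0 1 - {0} \<and> u \<in> ball 0 (cmod v ^ k)"
  using hartogs_snd_nonzero[of "vec2 u v"] by (auto simp: hartogs_mem_iff)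

lemma indicator_hartogs:
  "(indicator \<Omega> (vec2 u v) :: real) = indicator (ball 0 1 - {0}) v * indicator (ball 0 (cmod v ^ k)) u"
  using vec2_mem_hartogs[of u v] by (auto simp: indicator_def)

lemma hartogs_integrable_iff:
  fixes f :: "complex ^ 2 \<Rightarrow> 'b::{banach, second_countable_topology}"
  assumes "(\<lambda>z. indicator \<Omega> z *\<^sub>R f z) \<in> borel_measurable borel"
  shows "set_integrable lborel \<Omega> f \<longleftrightarrow> integrable (lborel \<Otimes>\<^sub>M lborel)
    (\<lambda>p. (indicator (ball 0 1 - {0}) (fst p) * indicator (ball 0 (cmod (fst p) ^ k)) (snd p)) *\<^sub>R
         f (vec2 (snd p) (fst p)))"
  unfolding set_integrable_def
  by (subst lborel_vec2, subst integrable_distr_eq) (use assms in \<open>auto simp: indicator_hartogs lborel_prod\<close>)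

text \<open>The slice of the domain at height \<open>z $ 2 = v\<close> is the disc of radius \<open>|v|\<^sup>k\<close>, and the
  heights fill the punctured unit disc.\<close>

lemma hartogs_fubini:
  fixes f :: "complex ^ 2 \<Rightarrow> 'b::{banach, second_countable_topology}"
  assumes f: "set_integrable lborel \<Omega> f"
  shows "AE v in lborel. v \<in> ball 0 1 - {0} \<longrightarrow>
            set_integrable lborel (ball 0 (cmod v ^ k)) (\<lambda>u. f (vec2 u v))"
    and "set_integrable lborel (ball 0 1 - {0}) (\<lambda>v. LINT u:ball 0 (cmod v ^ k)|lborel. f (vec2 u v))"
    and "(LINT z:\<Omega>|lborel. f z) =
           (LINT v:ball 0 1 - {0}|lborel. LINT u:ball 0 (cmod v ^ k)|lborel. f (vec2 u v))"
proof -
  define F where "F = (\<lambda>p. (indicator (ball 0 1 - {0}) (fst p) * indicator (ball 0 (cmod (fst p) ^ k)) (snd p)) *\<^sub>R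
         f (vec2 (snd p) (fst p)))"
  have meas: "(\<lambda>z. indicator \<Omega> z *\<^sub>R f z) \<in> borel_measurable borel"
    using f unfolding set_integrable_def by auto
  have F: "integrable (lborel \<Otimes>\<^sub>M lborel) F"
    using f hartogs_integrable_iff[OF meas] by (simp add: F_def)
  have slice: "(\<integral>u. F (v, u) \<partial>lborel) =
      indicator (ball 0 1 - {0}) v *\<^sub>R (LINT u:ball 0 (cmod v ^ k)|lborel. f (vec2 u v))" for v
    by (simp add: F_def set_lebesgue_integral_def flip: scaleR_scaleR)
  have "AE v in lborel. integrable lborel (\<lambda>u. F (v, u))"
    by (rule lborel_pair.AE_integrable_fst'[OF F])
  then show "AE v in lborel. v \<in> ball 0 1 - {0} \<longrightarrow>
            set_integrable lborel (ball 0 (cmod v ^ k)) (\<lambda>u. f (vec2 u v))"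
    by eventually_elim (auto simp: F_def set_integrable_def)
  show "set_integrable lborel (ball 0 1 - {0}) (\<lambda>v. LINT u:ball 0 (cmod v ^ k)|lborel. f (vec2 u v))"
    using lborel_pair.integrable_fst'[OF F] unfolding slice set_integrable_def .
  have "(LINT z:\<Omega>|lborel. f z) = integral\<^sup>L (lborel \<Otimes>\<^sub>M lborel) F"
    unfolding set_lebesgue_integral_def
    by (subst lborel_vec2, subst integral_distr) (use meas in \<open>auto simp: F_def indicator_hartogs lborel_prod\<close>)
  also have "\<dots> = (LINT v:ball 0 1 - {0}|lborel. LINT u:ball 0 (cmod v ^ k)|lborel. f (vec2 u v))"
    unfolding set_lebesgue_integral_def[of _ "ball 0 1 - {0}"] slice[symmetric]
    by (rule lborel_pair.integral_fst'[OF F, symmetric])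
  finally show "(LINT z:\<Omega>|lborel. f z) =
           (LINT v:ball 0 1 - {0}|lborel. LINT u:ball 0 (cmod v ^ k)|lborel. f (vec2 u v))" .
qed

text \<open>The slice at height \<open>v\<close> has area \<open>\<pi> |v|\<^sup>2\<^sup>k\<close>, which cancels the weight \<open>1 / |v|\<^sup>2\<^sup>k\<close>. Up
  to a constant, this weight dominates the squared modulus of the kernel.\<close>

lemma hartogs_weight_integrable:
  "set_integrable lborel \<Omega> (\<lambda>z. 1 / (cmod (z $ 2) ^ k)\<^sup>2)"
proof -
  define F :: "complex \<times> complex \<Rightarrow> real" where
    "F = (\<lambda>p. (indicator (ball 0 1 - {0}) (fst p) * indicator (ball 0 (cmod (fst p) ^ k)) (snd p)) *\<^sub>R
         (1 / (cmod (vec2 (snd p) (fst p) $ 2) ^ k)\<^sup>2))"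
  have "continuous_on \<Omega> (\<lambda>z. 1 / (cmod (z $ 2) ^ k)\<^sup>2)"
    by (intro continuous_intros) (use hartogs_snd_nonzero in auto)
  then have meas: "(\<lambda>z. indicator \<Omega> z *\<^sub>R (1 / (cmod (z $ 2) ^ k)\<^sup>2)) \<in> borel_measurable borel"
    using open_hartogs by (intro borel_measurable_continuous_on_indicator) auto
  have "F = (\<lambda>p. (\<lambda>z. indicator \<Omega> z *\<^sub>R (1 / (cmod (z $ 2) ^ k)\<^sup>2)) (vec2 (snd p) (fst p)))"
    by (simp add: F_def indicator_hartogs)
  also have "\<dots> \<in> borel_measurable (lborel \<Otimes>\<^sub>M lborel)"
    by (rule measurable_compose[OF _ meas]) (simp add: lborel_prod)
  finally have Fm: "F \<in> borel_measurable (lborel \<Otimes>\<^sub>M lborel)" .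
  have slice: "F (v, u) = (indicator (ball 0 1 - {0}) v / (cmod v ^ k)\<^sup>2) * indicator (ball 0 (cmod v ^ k)) u" for u v
    by (simp add: F_def)
  have int: "integrable lborel (\<lambda>u. F (v, u))" for v
    unfolding slice by (intro integrable_mult_right integrable_real_indicator) (auto simp: emeasure_ball)
  have "(\<integral>u. norm (F (v, u)) \<partial>lborel) = pi * indicator (ball 0 1 - {0}) v" for v
  proof -
    have "(\<integral>u. norm (F (v, u)) \<partial>lborel) = (\<integral>u. F (v, u) \<partial>lborel)"
      by (intro Bochner_Integration.integral_cong) (auto simp: slice)
    also have "\<dots> = (indicator (ball 0 1 - {0}) v / (cmod v ^ k)\<^sup>2) * measure lborel (ball (0::complex) (cmod v ^ k))"
      unfolding slice by simp
    also have "\<dots> = pi * indicator (ball 0 1 - {0}) v"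
      by (auto simp: content_ball unit_ball_vol_2 indicator_def measure_def emeasure_ball)
    finally show ?thesis .
  qed
  moreover have "integrable lborel (\<lambda>v::complex. pi * indicator (ball 0 1 - {0}) v)"
  proof (intro integrable_mult_right integrable_real_indicator)
    have "emeasure lborel (ball (0::complex) 1 - {0}) \<le> emeasure lborel (ball (0::complex) 1)"
      by (intro emeasure_mono) auto
    also have "\<dots> < \<infinity>" by (simp add: emeasure_ball)
    finally show "emeasure lborel (ball (0::complex) 1 - {0}) < \<infinity>" .
  qed auto
  ultimately have "integrable (lborel \<Otimes>\<^sub>M lborel) F"
    using int by (intro lborel_pair.Fubini_integrable Fm) auto
  then show ?thesis
    unfolding hartogs_integrable_iff[OF meas] F_def .
qed

lemma hartogs_kernel_denominator:
  assumes z: "z \<in> \<Omega>" and w: "w \<in> \<Omega>"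
  shows "1 - cmod (z $ 2) \<le> cmod (1 - z $ 2 * cnj (w $ 2))"
    and "(cmod (z $ 2) ^ k - cmod (z $ 1)) * cmod (w $ 2) ^ k \<le>
           cmod ((z $ 2 * cnj (w $ 2)) ^ k - z $ 1 * cnj (w $ 1))"
    and "1 - z $ 2 * cnj (w $ 2) \<noteq> 0"
    and "(z $ 2 * cnj (w $ 2)) ^ k - z $ 1 * cnj (w $ 1) \<noteq> 0"
proof -
  have "1 - cmod (z $ 2) * 1 \<le> 1 - cmod (z $ 2) * cmod (w $ 2)"
    using w by (intro diff_left_mono mult_left_mono) (auto simp: hartogs_mem_iff)
  also have "\<dots> \<le> cmod (1 - z $ 2 * cnj (w $ 2))"
    using norm_triangle_ineq2[of 1 "z $ 2 * cnj (w $ 2)"] by (simp add: norm_mult)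
  finally show 1: "1 - cmod (z $ 2) \<le> cmod (1 - z $ 2 * cnj (w $ 2))" by simp
  then show "1 - z $ 2 * cnj (w $ 2) \<noteq> 0" using z by (auto simp: hartogs_mem_iff)
  have "(cmod (z $ 2) ^ k - cmod (z $ 1)) * cmod (w $ 2) ^ k =
      cmod (z $ 2) ^ k * cmod (w $ 2) ^ k - cmod (z $ 1) * cmod (w $ 2) ^ k" by (simp add: algebra_simps)
  also have "\<dots> \<le> cmod (z $ 2) ^ k * cmod (w $ 2) ^ k - cmod (z $ 1) * cmod (w $ 1)"
    using w by (intro diff_left_mono mult_left_mono) (auto simp: hartogs_mem_iff)
  also have "\<dots> \<le> cmod ((z $ 2 * cnj (w $ 2)) ^ k - z $ 1 * cnj (w $ 1))"
    using norm_triangle_ineq2[of "(z $ 2 * cnj (w $ 2)) ^ k" "z $ 1 * cnj (w $ 1)"]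
    by (simp add: norm_mult norm_power power_mult_distrib)
  finally show 2: "(cmod (z $ 2) ^ k - cmod (z $ 1)) * cmod (w $ 2) ^ k \<le>
           cmod ((z $ 2 * cnj (w $ 2)) ^ k - z $ 1 * cnj (w $ 1))" .
  have "0 < (cmod (z $ 2) ^ k - cmod (z $ 1)) * cmod (w $ 2) ^ k"
    using z hartogs_snd_nonzero[OF w]
    by (intro mult_pos_pos zero_less_power) (auto simp: hartogs_mem_iff)
  with 2 have "0 < cmod ((z $ 2 * cnj (w $ 2)) ^ k - z $ 1 * cnj (w $ 1))"
    by (rule less_le_trans[rotated])
  then show "(z $ 2 * cnj (w $ 2)) ^ k - z $ 1 * cnj (w $ 1) \<noteq> 0"
    unfolding zero_less_norm_iff .
qed

text \<open>For fixed \<open>z\<close> the triangle inequality bounds the denominator below by a positive multiple of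
  \<open>|w $ 2|\<^sup>2\<^sup>k\<close>, while the numerator is a multiple of \<open>|w $ 2|\<^sup>k\<close>.\<close>

lemma hartogs_kernel_in_bergman_space:
  assumes z: "z \<in> \<Omega>"
  shows "(\<lambda>w. cnj (hartogs_kernel k z w)) \<in> bergman_space \<Omega>"
proof -
  have "holomorphic_vec_on (\<lambda>w. (cnj (z $ 2) * w $ 2) ^ k /
      ((complex_of_real pi)\<^sup>2 * (1 - cnj (z $ 2) * w $ 2)\<^sup>2 *
       ((cnj (z $ 2) * w $ 2) ^ k - cnj (z $ 1) * w $ 1)\<^sup>2)) \<Omega>"
  proof (intro holomorphic_vec_on_divide holomorphic_vec_on_mult holomorphic_vec_on_power
      holomorphic_vec_on_diff holomorphic_vec_on_const holomorphic_vec_on_nth)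
    fix w assume w: "w \<in> \<Omega>"
    have "cnj (1 - z $ 2 * cnj (w $ 2)) \<noteq> 0" "cnj ((z $ 2 * cnj (w $ 2)) ^ k - z $ 1 * cnj (w $ 1)) \<noteq> 0"
      using hartogs_kernel_denominator(3,4)[OF z w] by (simp_all only: complex_cnj_zero_iff not_False_eq_True)
    then show "(complex_of_real pi)\<^sup>2 * (1 - cnj (z $ 2) * w $ 2)\<^sup>2 *
       ((cnj (z $ 2) * w $ 2) ^ k - cnj (z $ 1) * w $ 1)\<^sup>2 \<noteq> 0" by simp
  qed
  then have hol: "holomorphic_vec_on (\<lambda>w. cnj (hartogs_kernel k z w)) \<Omega>"
    by (simp add: hartogs_kernel_def Let_def)
  define C where "C = cmod (z $ 2) ^ k / (pi\<^sup>2 * (1 - cmod (z $ 2))\<^sup>2 * (cmod (z $ 2) ^ k - cmod (z $ 1))\<^sup>2)"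
  have pos: "0 < 1 - cmod (z $ 2)" "0 < cmod (z $ 2) ^ k - cmod (z $ 1)"
    using z by (auto simp: hartogs_mem_iff)
  have bound: "cmod (hartogs_kernel k z w) \<le> C * (1 / cmod (w $ 2) ^ k)" if w: "w \<in> \<Omega>" for w
  proof -
    have w2: "cmod (w $ 2) > 0" using hartogs_snd_nonzero[OF w] by simp
    have "cmod (hartogs_kernel k z w) = cmod (z $ 2) ^ k * cmod (w $ 2) ^ k /
        (pi\<^sup>2 * (cmod (1 - z $ 2 * cnj (w $ 2)))\<^sup>2 * (cmod ((z $ 2 * cnj (w $ 2)) ^ k - z $ 1 * cnj (w $ 1)))\<^sup>2)"
      by (simp add: hartogs_kernel_def Let_def norm_divide norm_mult norm_power power_mult_distrib)
    also have "\<dots> \<le> cmod (z $ 2) ^ k * cmod (w $ 2) ^ k /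
        (pi\<^sup>2 * (1 - cmod (z $ 2))\<^sup>2 * ((cmod (z $ 2) ^ k - cmod (z $ 1)) * cmod (w $ 2) ^ k)\<^sup>2)"
    proof (rule frac_le)
      have "(1 - cmod (z $ 2))\<^sup>2 \<le> (cmod (1 - z $ 2 * cnj (w $ 2)))\<^sup>2"
        using hartogs_kernel_denominator(1)[OF z w] pos by (intro power_mono) simp_all
      moreover have "((cmod (z $ 2) ^ k - cmod (z $ 1)) * cmod (w $ 2) ^ k)\<^sup>2 \<le>
          (cmod ((z $ 2 * cnj (w $ 2)) ^ k - z $ 1 * cnj (w $ 1)))\<^sup>2"
        using hartogs_kernel_denominator(2)[OF z w] pos w2
        by (intro power_mono mult_nonneg_nonneg) simp_all
      ultimately show "pi\<^sup>2 * (1 - cmod (z $ 2))\<^sup>2 * ((cmod (z $ 2) ^ k - cmod (z $ 1)) * cmod (w $ 2) ^ k)\<^sup>2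
          \<le> pi\<^sup>2 * (cmod (1 - z $ 2 * cnj (w $ 2)))\<^sup>2 * (cmod ((z $ 2 * cnj (w $ 2)) ^ k - z $ 1 * cnj (w $ 1)))\<^sup>2"
        by (intro mult_mono order_refl mult_nonneg_nonneg zero_le_power2)
      show "0 < pi\<^sup>2 * (1 - cmod (z $ 2))\<^sup>2 * ((cmod (z $ 2) ^ k - cmod (z $ 1)) * cmod (w $ 2) ^ k)\<^sup>2"
        using pos w2 by (intro mult_pos_pos zero_less_power) simp_all
    qed simp_all
    also have "\<dots> = C * (1 / cmod (w $ 2) ^ k)"
      using pos w2 by (simp add: C_def power_mult_distrib power2_eq_square)
    finally show ?thesis .
  qed
  have "set_integrable lborel \<Omega> (\<lambda>w. (cmod (cnj (hartogs_kernel k z w)))\<^sup>2)"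
    unfolding set_integrable_def
  proof (rule Bochner_Integration.integrable_bound)
    show "integrable lborel (\<lambda>w. C\<^sup>2 *\<^sub>R (indicator \<Omega> w *\<^sub>R (1 / (cmod (w $ 2) ^ k)\<^sup>2)))"
      using hartogs_weight_integrable unfolding set_integrable_def by (intro integrable_scaleR_right)
    have "continuous_on \<Omega> (\<lambda>w. (cmod (cnj (hartogs_kernel k z w)))\<^sup>2)"
      by (intro continuous_intros holomorphic_vec_on_imp_continuous_on hol)
    then show "(\<lambda>w. indicator \<Omega> w *\<^sub>R (cmod (cnj (hartogs_kernel k z w)))\<^sup>2) \<in> borel_measurable lborel"
      using open_hartogs
        borel_measurable_continuous_on_indicator[of \<Omega> "\<lambda>w. (cmod (cnj (hartogs_kernel k z w)))\<^sup>2"]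
      by simp
    show "AE w in lborel. norm (indicator \<Omega> w *\<^sub>R (cmod (cnj (hartogs_kernel k z w)))\<^sup>2) \<le>
        norm (C\<^sup>2 *\<^sub>R (indicator \<Omega> w *\<^sub>R (1 / (cmod (w $ 2) ^ k)\<^sup>2)))"
    proof (rule AE_I2)
      fix w
      show "norm (indicator \<Omega> w *\<^sub>R (cmod (cnj (hartogs_kernel k z w)))\<^sup>2) \<le>
        norm (C\<^sup>2 *\<^sub>R (indicator \<Omega> w *\<^sub>R (1 / (cmod (w $ 2) ^ k)\<^sup>2)))"
        using power_mono[OF bound, of w 2] by (cases "w \<in> \<Omega>") (auto simp: power_divide)
    qed
  qed
  with hol show ?thesis by (simp add: bergman_space_def)
qed

text \<open>With \<open>R = |v|\<^sup>k\<close> and \<open>a = z $ 1 / z $ 2 ^ k * v ^ k\<close>, a point of the slice at height \<open>v\<close>, one has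
  \<open>R\<^sup>2 - a cnj u = v ^ k / z $ 2 ^ k * (t ^ k - s)\<close>, because \<open>R\<^sup>2 = v ^ k * cnj v ^ k\<close>. So on the slice the
  kernel is, up to a factor independent of \<open>u\<close>, the Bergman kernel of the disc of radius \<open>R\<close> at \<open>a\<close>.\<close>

lemma hartogs_kernel_slice:
  assumes z: "z \<in> \<Omega>" and v: "v \<in> ball 0 1 - {0}"
    and g: "g holomorphic_on ball 0 (cmod v ^ k)" "set_integrable lborel (ball 0 (cmod v ^ k)) g"
  shows "(LINT u:ball 0 (cmod v ^ k)|lborel. hartogs_kernel k z (vec2 u v) * g u) =
    1 / (pi * z $ 2 ^ k) * (v ^ k * g (z $ 1 / z $ 2 ^ k * v ^ k) / (1 - z $ 2 * cnj v)\<^sup>2)"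
proof -
  define R where "R = cmod v ^ k"
  define a where "a = z $ 1 / z $ 2 ^ k * v ^ k"
  have z2: "z $ 2 \<noteq> 0" by (rule hartogs_snd_nonzero[OF z])
  have v0: "v \<noteq> 0" and R: "R > 0" using v by (auto simp: R_def)
  have a: "cmod a < R"
    using mult_strict_right_mono[OF hartogs_ratio_less_one[OF z] R]
    unfolding a_def norm_mult R_def norm_power by simp
  have RR: "complex_of_real (R\<^sup>2) = v ^ k * cnj v ^ k"
    using complex_norm_square[of "v ^ k"] by (simp add: R_def norm_power)
  have ker: "hartogs_kernel k z (vec2 u v) * g u =
      (v ^ k * R\<^sup>2 / (z $ 2 ^ k * pi\<^sup>2 * (1 - z $ 2 * cnj v)\<^sup>2)) * (g u / (R\<^sup>2 - a * cnj u)\<^sup>2)" for u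
  proof -
    have e: "R\<^sup>2 - a * cnj u = v ^ k / z $ 2 ^ k * ((z $ 2 * cnj v) ^ k - z $ 1 * cnj u)"
      unfolding RR using z2 by (simp add: a_def field_simps)
    have alg: "P * Q / (p * D * X\<^sup>2) * G = V * (V * Q) / (P * p * D) * (G / (V / P * X)\<^sup>2)"
      if "P \<noteq> 0" "V \<noteq> 0" for P Q V p D X G :: complex
      using that by (simp add: power_divide power_mult_distrib) (simp add: power2_eq_square mult_ac)
    have "hartogs_kernel k z (vec2 u v) * g u = z $ 2 ^ k * cnj v ^ k /
        (pi\<^sup>2 * (1 - z $ 2 * cnj v)\<^sup>2 * ((z $ 2 * cnj v) ^ k - z $ 1 * cnj u)\<^sup>2) * g u"
      by (simp add: hartogs_kernel_def Let_def power_mult_distrib)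
    also have "\<dots> = v ^ k * (v ^ k * cnj v ^ k) / (z $ 2 ^ k * pi\<^sup>2 * (1 - z $ 2 * cnj v)\<^sup>2) *
        (g u / (v ^ k / z $ 2 ^ k * ((z $ 2 * cnj v) ^ k - z $ 1 * cnj u))\<^sup>2)"
      using z2 v0 by (intro alg) auto
    finally show ?thesis unfolding e [symmetric] RR [symmetric] .
  qed
  have "(LINT u:ball 0 R|lborel. hartogs_kernel k z (vec2 u v) * g u) =
      (v ^ k * R\<^sup>2 / (z $ 2 ^ k * pi\<^sup>2 * (1 - z $ 2 * cnj v)\<^sup>2)) *
      (LINT u:ball 0 R|lborel. g u / (R\<^sup>2 - a * cnj u)\<^sup>2)"
    unfolding ker by (rule set_integral_mult_right)
  also have "(LINT u:ball 0 R|lborel. g u / (R\<^sup>2 - a * cnj u)\<^sup>2) = pi * g a / R\<^sup>2"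
    using g a by (intro disc_reproducing) (auto simp: R_def)
  finally show ?thesis
    unfolding R_def [symmetric] a_def [symmetric] using R by (simp add: power2_eq_square mult_ac)
qed

text \<open>Integrating over the slices first reduces the claim to the reproducing formula on the punctured
  disc for \<open>h v = v ^ k * f (c * v ^ k, v)\<close>, where \<open>c = z $ 1 / z $ 2 ^ k\<close>; note that
  \<open>h (z $ 2) = z $ 2 ^ k * f z\<close>. The factor \<open>v ^ k\<close> makes \<open>h\<close> square-integrable: the point \<open>c * v ^ k\<close> keeps the
  relative distance \<open>1 - |c|\<close> from the boundary of the slice, so \<open>|h v|\<^sup>2\<close> is at most a constant times
  the integral of \<open>|f|\<^sup>2\<close> over the slice.\<close>

lemma hartogs_kernel_reproducing:
  assumes f: "f \<in> bergman_space \<Omega>" and z: "z \<in> \<Omega>"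
  shows "f z = (LINT w:\<Omega>|lborel. hartogs_kernel k z w * f w)"
proof -
  define c where "c = z $ 1 / z $ 2 ^ k"
  define h where "h = (\<lambda>v. v ^ k * f (vec2 (c * v ^ k) v))"
  have c: "cmod c < 1" unfolding c_def by (rule hartogs_ratio_less_one[OF z])
  have z2: "z $ 2 \<noteq> 0" "cmod (z $ 2) < 1" using hartogs_snd_nonzero[OF z] z by (auto simp: hartogs_mem_iff)
  have fhol: "holomorphic_vec_on f \<Omega>" and fsq: "set_integrable lborel \<Omega> (\<lambda>w. (cmod (f w))\<^sup>2)"
    using f by (auto simp: bergman_space_def)
  have cv: "cmod (c * v ^ k) < cmod v ^ k" if "v \<noteq> 0" for v
    using mult_strict_right_mono[OF c, of "cmod v ^ k"] that by (simp add: norm_mult norm_power)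
  have hhol: "h holomorphic_on ball 0 1 - {0}"
    unfolding h_def
    by (intro holomorphic_intros holomorphic_on_compose_vec2[OF fhol])
       (use cv in \<open>auto simp: vec2_mem_hartogs\<close>)
  have hcont: "continuous_on (ball 0 1 - {0}) h" using hhol by (rule holomorphic_on_imp_continuous_on)
  have ghol: "(\<lambda>u. f (vec2 u v)) holomorphic_on ball 0 (cmod v ^ k)" if "v \<in> ball 0 1 - {0}" for v
    using that by (intro holomorphic_on_compose_vec2[OF fhol] holomorphic_intros)
      (auto simp: vec2_mem_hartogs)
  note fslice = hartogs_fubini[OF fsq]
  have hsq: "set_integrable lborel (ball 0 1 - {0}) (\<lambda>v. (cmod (h v))\<^sup>2)"
    unfolding set_integrable_def
  proof (rule Bochner_Integration.integrable_bound)
    show "integrable lborel (\<lambda>v. (1 / (pi * (1 - cmod c)\<^sup>2)) *\<^sub>R (indicator (ball 0 1 - {0}) v *\<^sub>R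
        (LINT u:ball 0 (cmod v ^ k)|lborel. (cmod (f (vec2 u v)))\<^sup>2)))"
      using fslice(2) unfolding set_integrable_def by (rule integrable_scaleR_right)
    show "(\<lambda>v. indicator (ball 0 1 - {0}) v *\<^sub>R (cmod (h v))\<^sup>2) \<in> borel_measurable lborel"
      using borel_measurable_continuous_on_indicator[of "ball 0 1 - {0}" "\<lambda>v. (cmod (h v))\<^sup>2"] hcont
      by (simp add: continuous_on_power continuous_on_norm)
    show "AE v in lborel. norm (indicator (ball 0 1 - {0}) v *\<^sub>R (cmod (h v))\<^sup>2) \<le>
      norm ((1 / (pi * (1 - cmod c)\<^sup>2)) *\<^sub>R (indicator (ball 0 1 - {0}) v *\<^sub>R
        (LINT u:ball 0 (cmod v ^ k)|lborel. (cmod (f (vec2 u v)))\<^sup>2)))"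
      using fslice(1)
    proof eventually_elim
      case (elim v)
      show ?case
      proof (cases "v \<in> ball 0 1 - {0}")
        case True
        define J where "J = (LINT u:ball 0 (cmod v ^ k)|lborel. (cmod (f (vec2 u v)))\<^sup>2)"
        have "pi * (cmod v ^ k - cmod (c * v ^ k))\<^sup>2 * (cmod (f (vec2 (c * v ^ k) v)))\<^sup>2 \<le> J"
          unfolding J_def using True elim cv[of v] by (intro disc_point_evaluation_bound ghol) auto
        moreover have "cmod v ^ k - cmod (c * v ^ k) = (1 - cmod c) * cmod v ^ k"
          by (simp add: norm_mult norm_power algebra_simps)
        ultimately have "pi * (1 - cmod c)\<^sup>2 * (cmod (h v))\<^sup>2 \<le> J"
          by (simp add: h_def norm_mult norm_power power_mult_distrib mult.assoc)
        then have le: "(cmod (h v))\<^sup>2 \<le> J / (pi * (1 - cmod c)\<^sup>2)"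
          using c by (simp add: pos_le_divide_eq mult_ac)
        have "norm (indicator (ball 0 1 - {0}) v *\<^sub>R (cmod (h v))\<^sup>2) = (cmod (h v))\<^sup>2"
          using True by simp
        also have "\<dots> \<le> norm (J / (pi * (1 - cmod c)\<^sup>2))"
          using le unfolding real_norm_def by (rule order_trans[OF _ abs_ge_self])
        also have "J / (pi * (1 - cmod c)\<^sup>2) = (1 / (pi * (1 - cmod c)\<^sup>2)) *\<^sub>R
            (indicator (ball 0 1 - {0}) v *\<^sub>R J)"
          using True by simp
        finally show ?thesis unfolding J_def .
      qed simp
    qed
  qed
  have Kf: "set_integrable lborel \<Omega> (\<lambda>w. hartogs_kernel k z w * f w)"
    using bergman_space_mult_integrable[OF open_hartogs hartogs_kernel_in_bergman_space[OF z] f] .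
  have "(LINT w:\<Omega>|lborel. hartogs_kernel k z w * f w) = (LINT v:ball 0 1 - {0}|lborel.
      LINT u:ball 0 (cmod v ^ k)|lborel. hartogs_kernel k z (vec2 u v) * f (vec2 u v))"
    by (rule hartogs_fubini(3)[OF Kf])
  also have "\<dots> = (LINT v:ball 0 1 - {0}|lborel. 1 / (pi * z $ 2 ^ k) * (h v / (1 - z $ 2 * cnj v)\<^sup>2))"
    unfolding set_lebesgue_integral_def[of _ "ball 0 1 - {0}"]
  proof (rule integral_cong_AE)
    show "(\<lambda>v. indicator (ball 0 1 - {0}) v *\<^sub>R (LINT u:ball 0 (cmod v ^ k)|lborel.
        hartogs_kernel k z (vec2 u v) * f (vec2 u v))) \<in> borel_measurable lborel"
      using hartogs_fubini(2)[OF Kf] unfolding set_integrable_def by auto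
    have "1 - z $ 2 * cnj v \<noteq> 0" if "v \<in> ball 0 1 - {0}" for v
      using disc_kernel_denominator_bounds(2)[of "z $ 2" 1 v] z2 that by simp
    then have "continuous_on (ball 0 1 - {0}) (\<lambda>v. 1 / (pi * z $ 2 ^ k) * (h v / (1 - z $ 2 * cnj v)\<^sup>2))"
      using z2 by (intro continuous_intros hcont) auto
    then show "(\<lambda>v. indicator (ball 0 1 - {0}) v *\<^sub>R
        (1 / (pi * z $ 2 ^ k) * (h v / (1 - z $ 2 * cnj v)\<^sup>2))) \<in> borel_measurable lborel"
      using borel_measurable_continuous_on_indicator[of "ball 0 1 - {0}"] by simp
    show "AE v in lborel. indicator (ball 0 1 - {0}) v *\<^sub>R (LINT u:ball 0 (cmod v ^ k)|lborel.
        hartogs_kernel k z (vec2 u v) * f (vec2 u v)) = indicator (ball 0 1 - {0}) v *\<^sub>R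
        (1 / (pi * z $ 2 ^ k) * (h v / (1 - z $ 2 * cnj v)\<^sup>2))"
      using fslice(1)
    proof eventually_elim
      case (elim v)
      show ?case
      proof (cases "v \<in> ball 0 1 - {0}")
        case True
        have "set_integrable lborel (ball 0 (cmod v ^ k)) (\<lambda>u. f (vec2 u v))"
          using True elim holomorphic_on_imp_continuous_on[OF ghol[OF True]]
          by (intro set_integrable_of_square) (auto simp: emeasure_ball)
        then show ?thesis
          using hartogs_kernel_slice[OF z True ghol[OF True]] by (simp add: h_def c_def)
      qed simp
    qed
  qed
  also have "\<dots> = 1 / (pi * z $ 2 ^ k) * (LINT v:ball 0 1 - {0}|lborel. h v / (1 - z $ 2 * cnj v)\<^sup>2)"
    by (rule set_integral_mult_right)
  also have "\<dots> = 1 / (pi * z $ 2 ^ k) * (pi * h (z $ 2))"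
    using punctured_disc_reproducing[OF hhol hsq z2] by simp
  also have "\<dots> = f z"
    using z2 by (simp add: h_def c_def)
  finally show ?thesis ..
qed

lemma bergman_kernel_hartogs:
  "bergman_kernel \<Omega> = (\<lambda>z w. if z \<in> \<Omega> \<and> w \<in> \<Omega> then hartogs_kernel k z w else 0)"
proof (rule bergman_kernel_eqI[OF open_hartogs])
  define B where "B = (\<lambda>z w. if z \<in> \<Omega> \<and> w \<in> \<Omega> then hartogs_kernel k z w else 0)"
  have eq: "B z w = hartogs_kernel k z w" if "z \<in> \<Omega>" "w \<in> \<Omega>" for z w
    using that by (simp add: B_def)
  show "is_bergman_kernel \<Omega> B"
    unfolding is_bergman_kernel_def
  proof (intro conjI ballI)
    fix z assume z: "z \<in> \<Omega>"
    have "holomorphic_vec_on (\<lambda>w. cnj (B z w)) \<Omega> \<longleftrightarrow> holomorphic_vec_on (\<lambda>w. cnj (hartogs_kernel k z w)) \<Omega>"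
      using z by (intro holomorphic_vec_on_cong open_hartogs) (simp add: eq)
    moreover have "set_integrable lborel \<Omega> (\<lambda>w. (cmod (cnj (B z w)))\<^sup>2) \<longleftrightarrow>
        set_integrable lborel \<Omega> (\<lambda>w. (cmod (cnj (hartogs_kernel k z w)))\<^sup>2)"
      using z by (intro set_integrable_cong) (simp_all add: eq)
    ultimately show "(\<lambda>w. cnj (B z w)) \<in> bergman_space \<Omega>"
      using hartogs_kernel_in_bergman_space[OF z] by (simp add: bergman_space_def)
  next
    fix f z assume f: "f \<in> bergman_space \<Omega>" and z: "z \<in> \<Omega>"
    have "(LINT w:\<Omega>|lborel. B z w * f w) = (LINT w:\<Omega>|lborel. hartogs_kernel k z w * f w)"
      using z open_hartogs by (intro set_lebesgue_integral_cong) (auto simp: eq)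
    then show "f z = (LINT w:\<Omega>|lborel. B z w * f w)"
      using hartogs_kernel_reproducing[OF f z] by simp
  qed
qed auto

end

theorem theorem1p4:
  fixes k :: nat and z w :: "complex ^ 2"
  assumes "k > 0"
    and "z \<in> hartogs_triangle (1 / real k)"
    and "w \<in> hartogs_triangle (1 / real k)"
  shows "bergman_kernel (hartogs_triangle (1 / real k)) z w =
    (let s = z $ 1 * cnj (w $ 1); t = z $ 2 * cnj (w $ 2)
     in t ^ k / ((complex_of_real pi)\<^sup>2 * (1 - t)\<^sup>2 * (t ^ k - s)\<^sup>2))"
  using assms by (simp add: bergman_kernel_hartogs hartogs_kernel_def)

end
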